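(* For each of the two Gaspard–Gilbert kernels $W=W_{GG,2}$ (with $d=2$) and $W=W_{GG,3}$ (with $d=3$), the thermal conductivity $\kappa$, the static conductivity $\kappa_s$ and the static quantities $\kappa_1,\kappa_2,\kappa_f$ (all at temperature $T=1$) satisfy $$\kappa<\kappa_s=\kappa_1=\kappa_2=\kappa_f.$$
   Context: For $\varepsilon_a,\varepsilon_b>0$ and $-\varepsilon_b<\eta<\varepsilon_a$, $W(\varepsilon_a,\varepsilon_b\,|\,\varepsilon_a-\eta,\varepsilon_b+\eta)\ge0$ is the rate at which an amount $\eta$ of energy is moved from a site with energy $\varepsilon_a$ to a neighbouring site with energy $\varepsilon_b$. Kernel $W_{GG,2}$: for $\varepsilon_a\le\varepsilon_b$, $$W_{GG,2}(\varepsilon_a,\varepsilon_b|\varepsilon_a-\eta,\varepsilon_b+\eta)=\sqrt{\tfrac{2}{\pi^3}}\times\begin{cases}\sqrt{\frac1{\varepsilon_a}}\,K\big(\sqrt{\frac{\varepsilon_b+\eta}{\varepsilon_a}}\big)&-\varepsilon_b<\eta<\varepsilon_a-\varepsilon_b\\ \sqrt{\frac1{\varepsilon_b+\eta}}\,K\big(\sqrt{\frac{\varepsilon_a}{\varepsilon_b+\eta}}\big)&\varepsilon_a-\varepsilon_b<\eta<0\\ \sqrt{\frac1{\varepsilon_b}}\,K\big(\sqrt{\frac{\varepsilon_a-\eta}{\varepsilon_b}}\big)&0<\eta<\varepsilon_a\end{cases}$$ with $K(m)=\int_0^{\pi/2}\frac{d\theta}{\sqrt{1-m^2\sin^2\theta}}$;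 for $\varepsilon_a\ge\varepsilon_b$, $W_{GG,2}(\varepsilon_a,\varepsilon_b|\varepsilon_a-\eta,\varepsilon_b+\eta)=W_{GG,2}(\varepsilon_b,\varepsilon_a|\varepsilon_b+\eta,\varepsilon_a-\eta)$. Kernel $W_{GG,3}$: $$W_{GG,3}(\varepsilon_a,\varepsilon_b|\varepsilon_a-\eta,\varepsilon_b+\eta)=\sqrt{\tfrac{\pi}{8}}\times\begin{cases}\sqrt{\frac{\varepsilon_b+\eta}{\varepsilon_a\varepsilon_b}}&-\varepsilon_b<\eta<\min\{0,\varepsilon_a-\varepsilon_b\}\\ \sqrt{\frac1{\max\{\varepsilon_a,\varepsilon_b\}}}&\min\{0,\varepsilon_a-\varepsilon_b\}<\eta<\max\{0,\varepsilon_a-\varepsilon_b\}\\ \sqrt{\frac{\varepsilon_a-\eta}{\varepsilon_a\varepsilon_b}}&\max\{0,\varepsilon_a-\varepsilon_b\}<\eta<\varepsilon_a.\end{cases}$$ $\langle\cdot\rangle_T$ is expectation when the energies $(\varepsilon_i)_{i\in\mathbb{Z}}$ are i.i.d. with density $\varepsilon^{\frac d2-1}e^{-\varepsilon/T}/(T^{d/2}\Gamma(d/2))$ on $(0,\infty)$. Let $\nu,j,h$ be $\int_{-\varepsilon_b}^{\varepsilon_a}\eta^k\,W(\varepsilon_a,\varepsilon_b|\varepsilon_a-\eta,\varepsilon_b+\eta)\,d\eta$ for $k=0,1,2$ respectively. For two neighbouring sites $a\neq b$, $$\kappa_1=\tfrac12\langle(\varepsilon_a-\varepsilon_b)j(\varepsilon_a,\varepsilon_b)\rangle_1,\quad\kappa_2=\tfrac12\langle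 h(\varepsilon_a,\varepsilon_b)\rangle_1,\quad\kappa_f=\langle\nu(\varepsilon_a,\varepsilon_b)\rangle_1,\quad\kappa_s=-\sum_{i\in\mathbb{Z}}i\langle\varepsilon_i\,j(\varepsilon_0,\varepsilon_1)\rangle_1.$$ Thermal conductivity: $\kappa=\kappa(1)$, where $\kappa(T)=-\frac{1}{4T^2}\lim_{t\to\infty}\frac1t\sum_{i\in\mathbb{Z}}i^2\langle(\varepsilon_i(t)-\varepsilon_i(0))(\varepsilon_0(t)-\varepsilon_0(0))\rangle_{\mathbb{P}_T}$ and $\mathbb{P}_T$ is the law of the infinite-volume Markov dynamics on $\mathbb{Z}$ (each nearest-neighbour pair $(i,i+1)$ performs $(\varepsilon_i,\varepsilon_{i+1})\mapsto(\varepsilon_i-\eta,\varepsilon_{i+1}+\eta)$ with rate $W(\varepsilon_i,\varepsilon_{i+1}|\varepsilon_i-\eta,\varepsilon_{i+1}+\eta)\,d\eta$) started from equilibrium at temperature $T$. It is taken as known (standard for reversible models), and may be used as the definition of $\kappa$, that $$\kappa=\frac12\inf_f\Big\langle\int_{-\varepsilon_1}^{\varepsilon_0}W(\varepsilon_0,\varepsilon_1|\varepsilon_0-\eta,\varepsilon_1+\eta)\big(\eta+\nabla_{0,1,\eta}\Sigma_f\big)^2d\eta\Big\rangle_1,$$ the infimum being over all cylinder functions $f$ (square-integrable functions of finitely many of the $\varepsilon_i$). Here $\tau_i$ is the lattice shift by $i$, $\Sigma_f=\sum_{i\in\mathbb{Z}}\tau_if$ is a formal sum, and $\nabla_{0,1,\eta}\Sigma_f=\Sigma_f(\dots,\varepsilon_0-\eta,\varepsilon_1+\eta,\dots)-\Sigma_f(\dots,\varepsilon_0,\varepsilon_1,\dots)$,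 computed termwise (only finitely many terms are nonzero). *)

theory Defs
  imports "HOL-Probability.Probability"
begin

text \<open>
  A kernel is a function \<open>W a b \<eta>\<close>, standing for the rate
  \<open>W(a, b | a - \<eta>, b + \<eta>)\<close>, meaningful for \<open>a, b > 0\<close> and \<open>-b < \<eta> < a\<close>.
  In particular \<open>W(b, a | b + \<eta>, a - \<eta>)\<close> is \<open>W b a (-\<eta>)\<close>.
  The kernels below are set to 0 at the finitely many \<open>\<eta>\<close> not covered by the
  (strict) case distinctions; kernels only ever occur integrated over \<open>\<eta>\<close>.
\<close>

type_synonym kernel = "real \<Rightarrow> real \<Rightarrow> real \<Rightarrow> real"

text \<open>The argument is the elliptic modulus, not its square.\<close>

definition elliptic_K :: "real \<Rightarrow> real" where
  "elliptic_K m = (LINT \<theta>:{0..pi/2}|lborel. 1 / sqrt (1 - m\<^sup>2 * (sin \<theta>)\<^sup>2))"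

definition W_GG2_le :: kernel where
  "W_GG2_le a b \<eta> = sqrt (2 / pi ^ 3) *
     (if - b < \<eta> \<and> \<eta> < a - b then sqrt (1 / a) * elliptic_K (sqrt ((b + \<eta>) / a))
      else if a - b < \<eta> \<and> \<eta> < 0 then sqrt (1 / (b + \<eta>)) * elliptic_K (sqrt (a / (b + \<eta>)))
      else if 0 < \<eta> \<and> \<eta> < a then sqrt (1 / b) * elliptic_K (sqrt ((a - \<eta>) / b))
      else 0)"

definition W_GG2 :: kernel where
  "W_GG2 a b \<eta> = (if a \<le> b then W_GG2_le a b \<eta> else W_GG2_le b a (- \<eta>))"

definition W_GG3 :: kernel where
  "W_GG3 a b \<eta> = sqrt (pi / 8) *
     (if - b < \<eta> \<and> \<eta> < min 0 (a - b) then sqrt ((b + \<eta>) / (a * b))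
      else if min 0 (a - b) < \<eta> \<and> \<eta> < max 0 (a - b) then sqrt (1 / max a b)
      else if max 0 (a - b) < \<eta> \<and> \<eta> < a then sqrt ((a - \<eta>) / (a * b))
      else 0)"

definition energy_density :: "nat \<Rightarrow> real \<Rightarrow> real \<Rightarrow> real" where
  "energy_density d T x =
     (if 0 < x then x powr (real d / 2 - 1) * exp (- x / T) / (T powr (real d / 2) * Gamma (real d / 2))
      else 0)"

definition equilibrium :: "nat \<Rightarrow> real \<Rightarrow> (int \<Rightarrow> real) measure" where
  "equilibrium d T = (\<Pi>\<^sub>M i\<in>UNIV. density lborel (\<lambda>x. ennreal (energy_density d T x)))"

definition rate_moment :: "nat \<Rightarrow> kernel \<Rightarrow> real \<Rightarrow> real \<Rightarrow> real" where
  "rate_moment k W a b = (LINT \<eta>:{- b<..<a}|lborel. \<eta> ^ k * W a b \<eta>)"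

abbreviation \<nu>_rate :: "kernel \<Rightarrow> real \<Rightarrow> real \<Rightarrow> real" where "\<nu>_rate \<equiv> rate_moment 0"
abbreviation j_rate :: "kernel \<Rightarrow> real \<Rightarrow> real \<Rightarrow> real" where "j_rate \<equiv> rate_moment 1"
abbreviation h_rate :: "kernel \<Rightarrow> real \<Rightarrow> real \<Rightarrow> real" where "h_rate \<equiv> rate_moment 2"

text \<open>All conductivities are taken at temperature 1; \<open>a\<close> and \<open>b\<close> are lattice sites.\<close>

definition kappa1 :: "kernel \<Rightarrow> nat \<Rightarrow> int \<Rightarrow> int \<Rightarrow> real" where
  "kappa1 W d a b = 1/2 * (LINT \<epsilon>|equilibrium d 1. (\<epsilon> a - \<epsilon> b) * j_rate W (\<epsilon> a) (\<epsilon> b))"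

definition kappa2 :: "kernel \<Rightarrow> nat \<Rightarrow> int \<Rightarrow> int \<Rightarrow> real" where
  "kappa2 W d a b = 1/2 * (LINT \<epsilon>|equilibrium d 1. h_rate W (\<epsilon> a) (\<epsilon> b))"

definition kappa_f :: "kernel \<Rightarrow> nat \<Rightarrow> int \<Rightarrow> int \<Rightarrow> real" where
  "kappa_f W d a b = (LINT \<epsilon>|equilibrium d 1. \<nu>_rate W (\<epsilon> a) (\<epsilon> b))"

definition kappa_s :: "kernel \<Rightarrow> nat \<Rightarrow> real" where
  "kappa_s W d = - (\<Sum>\<^sub>\<infinity>i\<in>UNIV. of_int i * (LINT \<epsilon>|equilibrium d 1. \<epsilon> i * j_rate W (\<epsilon> 0) (\<epsilon> 1)))"

definition cylinder_functions :: "nat \<Rightarrow> ((int \<Rightarrow> real) \<Rightarrow> real) set" where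
  "cylinder_functions d = {f. f \<in> borel_measurable (equilibrium d 1) \<and>
     (\<exists>A. finite A \<and> (\<forall>\<epsilon> \<epsilon>'. (\<forall>i\<in>A. \<epsilon> i = \<epsilon>' i) \<longrightarrow> f \<epsilon> = f \<epsilon>')) \<and>
     integrable (equilibrium d 1) (\<lambda>\<epsilon>. (f \<epsilon>)\<^sup>2)}"

definition lattice_shift :: "int \<Rightarrow> ((int \<Rightarrow> real) \<Rightarrow> real) \<Rightarrow> (int \<Rightarrow> real) \<Rightarrow> real" where
  "lattice_shift i f \<epsilon> = f (\<lambda>k. \<epsilon> (k + i))"

text \<open>
  The gradient of the formal sum of all shifts of \<open>f\<close>, computed termwise. For cylinder
  functions only finitely many terms are nonzero.
\<close>

definition grad01 :: "real \<Rightarrow> ((int \<Rightarrow> real) \<Rightarrow> real) \<Rightarrow> (int \<Rightarrow> real) \<Rightarrow> real" where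
  "grad01 \<eta> f \<epsilon> =
     (\<Sum>\<^sub>\<infinity>i\<in>UNIV. lattice_shift i f (\<epsilon>(0 := \<epsilon> 0 - \<eta>, 1 := \<epsilon> 1 + \<eta>)) - lattice_shift i f \<epsilon>)"

text \<open>
  The thermal conductivity, through its variational formula. For unbounded rates the
  expectation may be infinite for some square-integrable \<open>f\<close>, so the infimum is taken
  in \<open>ennreal\<close>, where such \<open>f\<close> do not contribute; a Bochner integral would count them as 0.
\<close>

definition kappa :: "kernel \<Rightarrow> nat \<Rightarrow> real" where
  "kappa W d = 1/2 * enn2real (INF f\<in>cylinder_functions d.
     \<integral>\<^sup>+\<epsilon>. (\<integral>\<^sup>+\<eta>\<in>{- \<epsilon> 1<..<\<epsilon> 0}. ennreal (W (\<epsilon> 0) (\<epsilon> 1) \<eta> * (\<eta> + grad01 \<eta> f \<epsilon>)\<^sup>2) \<partial>lborel)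
       \<partial>equilibrium d 1)"

end

theory Submission
  imports Defs
begin

text \<open>
  Write \<open>\<beta> = (d - 1) / 2\<close>. Under the equilibrium at temperature 1, both kernels have the same
  representation: up to a constant, the law of a collision \<open>(a, b, \<eta>)\<close> is that of
  \<open>(u + z + s, v + z, s)\<close> plus that of \<open>(u + z, v + z + s, - s)\<close>, where \<open>z, u, v, s\<close> are independent
  Gamma variables with (shape, rate) equal to \<open>(1/2, 2)\<close>, \<open>(\<beta>, 1)\<close>, \<open>(\<beta>, 1)\<close>, \<open>(1, 1)\<close>.
  Since the transferred energy \<open>s\<close> is exponential with \<open>E s\<^sup>2 = 2\<close>, the static quantities coincide.

  The static value is the Dirichlet form at \<open>f = 0\<close>. Along \<open>f = t \<epsilon>\<^sub>0\<^sup>2 \<epsilon>\<^sub>1\<close> the form is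
  a finite quadratic polynomial in \<open>t\<close> whose linear coefficient, computed from the Gamma moments, is
  a positive multiple of a quantity that equals \<open>1/4\<close> for every \<open>\<beta>\<close>. So a small negative \<open>t\<close>
  strictly decreases it.
\<close>

subsection \<open>Gamma laws\<close>

text \<open>The shape 1/2 of \<open>z\<close> is what the two kernels share. For \<beta> = 1
  (\<open>d = 3\<close>) the integral of \<open>z powr (- 1/2)\<close> up to \<open>min u v\<close>
  is \<open>2 * sqrt (min u v)\<close>, the root in the rates. For \<beta> = 1/2
  (\<open>d = 2\<close>) the integral of the inverse root of \<open>z * (u - z) * (v - z)\<close> is
  a complete elliptic integral. So \<open>elliptic_K\<close> is never averaged as a special
  function: its defining integral turns into one more random variable. No polynomial of degree below
  three works as a trial function. Both kernels are invariant under exchanging the two sites while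
  \<eta> changes sign, hence reflecting \<open>f\<close> reverses the sign of the linear coefficient
  of the form, and this coefficient vanishes if the reflection of \<open>f\<close> is a shift of
  \<open>f\<close>. Every monomial of degree at most two in the energies has this property;
  \<open>\<epsilon>\<^sub>0\<^sup>2 \<epsilon>\<^sub>1\<close> does not. The rates are unbounded, so
  finiteness of each expectation has to be proved. It comes from the hidden variables: all
  quantities are polynomials in them, and Gamma laws have moments of every order.\<close>

definition gamma_density :: "real \<Rightarrow> real \<Rightarrow> real \<Rightarrow> real" where
  "gamma_density a c t =
     (if 0 < t then c powr a * t powr (a - 1) * exp (- (c * t)) / Gamma a else 0)"

definition gamma_law :: "real \<Rightarrow> real \<Rightarrow> real measure" where
  "gamma_law a c = density lborel (\<lambda>t. ennreal (gamma_density a c t))"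

lemma measurable_gamma_density [measurable]: "gamma_density a c \<in> borel_measurable borel"
  unfolding gamma_density_def by measurable

lemma gamma_density_nonneg: "0 < a \<Longrightarrow> 0 \<le> gamma_density a c t"
  by (simp add: gamma_density_def Gamma_real_pos less_imp_le)

lemma sets_gamma_law [simp, measurable_cong]: "sets (gamma_law a c) = sets borel"
  by (simp add: gamma_law_def)

lemma space_gamma_law [simp]: "space (gamma_law a c) = UNIV"
  by (simp add: gamma_law_def)

text \<open>Rescaling the variable by \<open>c\<close> reduces this to Euler's integral, the case
  \<open>c = 1\<close>.\<close>

lemma nn_integral_powr_exp:
  assumes a: "0 < a" and c: "0 < c"
  shows "(\<integral>\<^sup>+t. ennreal (if 0 < t then t powr (a - 1) * exp (- (c * t)) else 0) \<partial>lborel) =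
    ennreal (Gamma a / c powr a)"
proof -
  define f :: "real \<Rightarrow> real \<Rightarrow> real"
    where "f = (\<lambda>c t. if 0 < t then t powr (a - 1) * exp (- (c * t)) else 0)"
  have [measurable]: "f c \<in> borel_measurable borel" for c
    unfolding f_def by measurable
  have "ennreal (Gamma a) = (\<integral>\<^sup>+t. ennreal (f 1 t) \<partial>lborel)"
    unfolding Gamma_conv_nn_integral_real[OF a]
    by (intro nn_integral_cong_AE eventually_mono[OF AE_lborel_singleton[of 0]])
      (auto simp: f_def indicator_def exp_minus field_simps)
  also have "\<dots> = ennreal c * (\<integral>\<^sup>+t. ennreal (f 1 (c * t)) \<partial>lborel)"
    by (subst nn_integral_real_affine[where c = c and t = 0]) (use c in auto)
  also have "\<dots> = ennreal c * (\<integral>\<^sup>+t. ennreal (c powr (a - 1)) * ennreal (f c t) \<partial>lborel)"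
    using c by (intro arg_cong2[where f = "(*)"] nn_integral_cong)
      (auto simp: f_def ennreal_mult[symmetric] powr_mult zero_less_mult_iff)
  also have "\<dots> = ennreal (c * c powr (a - 1)) * (\<integral>\<^sup>+t. ennreal (f c t) \<partial>lborel)"
    using c by (subst nn_integral_cmult) (auto simp: ennreal_mult mult.assoc)
  also have "c * c powr (a - 1) = c powr a"
    using c by (simp add: powr_mult_base)
  finally have *: "ennreal (Gamma a) = ennreal (c powr a) * (\<integral>\<^sup>+t. ennreal (f c t) \<partial>lborel)" .
  have "ennreal (Gamma a / c powr a) = ennreal (1 / c powr a) * ennreal (Gamma a)"
    using a by (simp add: ennreal_mult[symmetric] Gamma_real_pos less_imp_le)
  also have "\<dots> = (ennreal (1 / c powr a) * ennreal (c powr a)) * (\<integral>\<^sup>+t. ennreal (f c t) \<partial>lborel)"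
    unfolding * by (simp add: mult.assoc)
  also have "ennreal (1 / c powr a) * ennreal (c powr a) = 1"
    using c by (simp add: ennreal_mult[symmetric])
  finally show ?thesis by (simp add: f_def)
qed

lemma nn_integral_gamma_law:
  assumes [measurable]: "f \<in> borel_measurable borel"
  shows "integral\<^sup>N (gamma_law a c) f = (\<integral>\<^sup>+t. ennreal (gamma_density a c t) * f t \<partial>lborel)"
  unfolding gamma_law_def by (subst nn_integral_density) auto

text \<open>The factor \<open>t ^ k\<close> only raises the shape from \<open>a\<close> to
  \<open>a + k\<close>, so the value is a quotient of two normalizing constants. The case
  \<open>k = 0\<close> gives total mass 1, the others give the absolute moments.\<close>

lemma nn_integral_gamma_law_power:
  assumes a: "0 < a" and c: "0 < c"
  shows "(\<integral>\<^sup>+t. ennreal (\<bar>t\<bar> ^ k) \<partial>gamma_law a c) = ennreal (Gamma (a + k) / (Gamma a * c ^ k))"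
proof -
  have G: "0 < Gamma a" "0 < Gamma (a + k)" using a by (auto simp: Gamma_real_pos)
  have "(\<integral>\<^sup>+t. ennreal (\<bar>t\<bar> ^ k) \<partial>gamma_law a c) =
      (\<integral>\<^sup>+t. ennreal (c powr a / Gamma a) *
        ennreal (if 0 < t then t powr ((a + k) - 1) * exp (- (c * t)) else 0) \<partial>lborel)"
  proof (subst nn_integral_gamma_law, simp, rule nn_integral_cong)
    fix t :: real
    have "t ^ k * t powr (a - 1) = t powr ((a + k) - 1)" if "0 < t"
      using that by (simp add: powr_realpow[symmetric] powr_add[symmetric] algebra_simps)
    then show "ennreal (gamma_density a c t) * ennreal (\<bar>t\<bar> ^ k) = ennreal (c powr a / Gamma a) *
        ennreal (if 0 < t then t powr ((a + k) - 1) * exp (- (c * t)) else 0)"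
      using G by (auto simp: gamma_density_def ennreal_mult[symmetric] less_imp_le field_simps)
  qed
  also have "\<dots> = ennreal (c powr a / Gamma a) * ennreal (Gamma (a + k) / c powr (a + k))"
    using a c by (subst nn_integral_cmult) (auto simp: nn_integral_powr_exp)
  also have "\<dots> = ennreal (Gamma (a + k) / (Gamma a * c ^ k))"
    using G c by (simp add: ennreal_mult[symmetric] powr_add powr_realpow less_imp_le)
  finally show ?thesis .
qed

lemma prob_space_gamma_law:
  assumes "0 < a" "0 < c"
  shows "prob_space (gamma_law a c)"
proof (rule prob_spaceI)
  have "Gamma a \<noteq> 0" using Gamma_real_pos[OF assms(1)] by linarith
  then show "emeasure (gamma_law a c) (space (gamma_law a c)) = 1"
    using nn_integral_gamma_law_power[OF assms, of 0] by simp
qed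

lemma AE_gamma_law_pos: "AE t in gamma_law a c. 0 < t"
  unfolding gamma_law_def by (subst AE_density) (auto simp: gamma_density_def)

lemma integrable_gamma_law_abs_power:
  assumes "0 < a" "0 < c"
  shows "integrable (gamma_law a c) (\<lambda>t. \<bar>t\<bar> ^ k)"
  using nn_integral_gamma_law_power[OF assms, of k] by (intro integrableI_bounded) auto

lemma integrable_gamma_law_power:
  assumes "0 < a" "0 < c"
  shows "integrable (gamma_law a c) (\<lambda>t. t ^ k)"
  by (rule Bochner_Integration.integrable_bound[OF integrable_gamma_law_abs_power[OF assms, of k]])
    (auto simp: power_abs)

lemma integral_gamma_law_power:
  assumes a: "0 < a" and c: "0 < c"
  shows "(LINT t|gamma_law a c. t ^ k) = pochhammer a k / c ^ k"
proof -
  have G: "0 < Gamma a" "0 < Gamma (a + k)" using a by (auto simp: Gamma_real_pos)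
  have "(LINT t|gamma_law a c. t ^ k) = (LINT t|gamma_law a c. \<bar>t\<bar> ^ k)"
    by (intro integral_cong_AE eventually_mono[OF AE_gamma_law_pos]) auto
  also have "\<dots> = Gamma (a + k) / (Gamma a * c ^ k)"
    using nn_integral_gamma_law_power[OF a c, of k] G c
    by (intro integral_eq_nn_integral[THEN trans]) (auto simp: less_imp_le)
  also have "\<dots> = pochhammer a k / c ^ k"
    using a by (subst pochhammer_Gamma) (auto simp: field_simps)
  finally show ?thesis .
qed

subsection \<open>Functions with finite moments of all orders\<close>

text \<open>Integrability is not closed under products, whereas finiteness of the absolute moments
  of all orders is. Every polynomial in the hidden variables thus becomes integrable by closure
  rules alone.\<close>

definition all_moments :: "'a measure \<Rightarrow> ('a \<Rightarrow> real) \<Rightarrow> bool" where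
  "all_moments M f \<longleftrightarrow> f \<in> borel_measurable M \<and> (\<forall>n. integrable M (\<lambda>x. \<bar>f x\<bar> ^ n))"

lemma all_moments_measurable: "all_moments M f \<Longrightarrow> f \<in> borel_measurable M"
  by (simp add: all_moments_def)

lemma all_moments_integrable:
  assumes "all_moments M f"
  shows "integrable M f"
proof -
  have "integrable M (\<lambda>x. \<bar>f x\<bar> ^ 1)" "f \<in> borel_measurable M"
    using assms unfolding all_moments_def by blast+
  then show ?thesis by (simp add: integrable_iff_bounded)
qed

lemma all_moments_const [simp]: "prob_space M \<Longrightarrow> all_moments M (\<lambda>_. c)"
  by (auto simp: all_moments_def prob_space.finite_measure finite_measure.integrable_const)

text \<open>By \<open>2 * x * y \<le> x^2 + y^2\<close> for the \<open>n\<close>-th powers, moments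
  of order \<open>n\<close> of the product are controlled by moments of order \<open>2 * n\<close>
  of the factors.\<close>

lemma all_moments_mult [simp]:
  assumes "all_moments M f" "all_moments M g"
  shows "all_moments M (\<lambda>x. f x * g x)"
proof -
  have [measurable]: "f \<in> borel_measurable M" "g \<in> borel_measurable M"
    using assms by (auto simp: all_moments_def)
  have "integrable M (\<lambda>x. \<bar>f x * g x\<bar> ^ n)" for n
  proof (rule Bochner_Integration.integrable_bound)
    show "integrable M (\<lambda>x. \<bar>f x\<bar> ^ (2 * n) + \<bar>g x\<bar> ^ (2 * n))"
      using assms by (auto simp: all_moments_def simp del: power_even_abs)
    have "\<bar>f x * g x\<bar> ^ n \<le> \<bar>f x\<bar> ^ (2 * n) + \<bar>g x\<bar> ^ (2 * n)" for x
    proof -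
      have "2 * (\<bar>f x\<bar> ^ n * \<bar>g x\<bar> ^ n) \<le> (\<bar>f x\<bar> ^ n)\<^sup>2 + (\<bar>g x\<bar> ^ n)\<^sup>2"
        using sum_squares_bound[of "\<bar>f x\<bar> ^ n" "\<bar>g x\<bar> ^ n"] by (simp add: mult.assoc)
      moreover have "0 \<le> \<bar>f x\<bar> ^ n * \<bar>g x\<bar> ^ n" by simp
      ultimately have "\<bar>f x\<bar> ^ n * \<bar>g x\<bar> ^ n \<le> (\<bar>f x\<bar> ^ n)\<^sup>2 + (\<bar>g x\<bar> ^ n)\<^sup>2" by linarith
      then show ?thesis
        unfolding power_mult_distrib abs_mult power_mult[symmetric] by (simp only: mult.commute)
    qed
    then show "AE x in M. norm (\<bar>f x * g x\<bar> ^ n) \<le> norm (\<bar>f x\<bar> ^ (2 * n) + \<bar>g x\<bar> ^ (2 * n))"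
      by (auto simp del: power_even_abs)
  qed measurable
  then show ?thesis by (simp add: all_moments_def)
qed

lemma all_moments_power [simp]:
  "prob_space M \<Longrightarrow> all_moments M f \<Longrightarrow> all_moments M (\<lambda>x. f x ^ n)"
  by (induction n) auto

lemma all_moments_add [simp]:
  assumes "all_moments M f" "all_moments M g"
  shows "all_moments M (\<lambda>x. f x + g x)"
proof -
  have [measurable]: "f \<in> borel_measurable M" "g \<in> borel_measurable M"
    using assms by (auto simp: all_moments_def)
  have "integrable M (\<lambda>x. \<bar>f x + g x\<bar> ^ n)" for n
  proof (rule Bochner_Integration.integrable_bound)
    show "integrable M (\<lambda>x. 2 ^ n * (\<bar>f x\<bar> ^ n + \<bar>g x\<bar> ^ n))"
      using assms by (auto simp: all_moments_def)
    have "\<bar>f x + g x\<bar> ^ n \<le> 2 ^ n * (\<bar>f x\<bar> ^ n + \<bar>g x\<bar> ^ n)" for x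
    proof -
      have "\<bar>f x + g x\<bar> ^ n \<le> (2 * max \<bar>f x\<bar> \<bar>g x\<bar>) ^ n"
        by (intro power_mono) auto
      also have "\<dots> = 2 ^ n * max \<bar>f x\<bar> \<bar>g x\<bar> ^ n" by (simp add: power_mult_distrib)
      also have "\<dots> \<le> 2 ^ n * (\<bar>f x\<bar> ^ n + \<bar>g x\<bar> ^ n)"
        by (intro mult_left_mono) (auto simp: max_def)
      finally show ?thesis .
    qed
    then show "AE x in M. norm (\<bar>f x + g x\<bar> ^ n) \<le> norm (2 ^ n * (\<bar>f x\<bar> ^ n + \<bar>g x\<bar> ^ n))"
      by auto
  qed measurable
  then show ?thesis by (simp add: all_moments_def)
qed

lemma all_moments_uminus [simp]: "all_moments M f \<Longrightarrow> all_moments M (\<lambda>x. - f x)"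
  by (simp add: all_moments_def)

lemma all_moments_diff [simp]:
  "all_moments M f \<Longrightarrow> all_moments M g \<Longrightarrow> all_moments M (\<lambda>x. f x - g x)"
  using all_moments_add[of M f "\<lambda>x. - g x"] by simp

lemma all_moments_gamma_law [simp]:
  "0 < a \<Longrightarrow> 0 < c \<Longrightarrow> all_moments (gamma_law a c) (\<lambda>t. t)"
  by (simp add: all_moments_def integrable_gamma_law_abs_power)

lemma (in prob_space) distr_pair_snd:
  assumes "sigma_finite_measure N"
  shows "distr (M \<Otimes>\<^sub>M N) N snd = N"
proof (rule measure_eqI)
  interpret N: sigma_finite_measure N by fact
  fix A assume "A \<in> sets (distr (M \<Otimes>\<^sub>M N) N snd)"
  then have A: "A \<in> sets N" by simp
  have "snd -` A \<inter> space (M \<Otimes>\<^sub>M N) = space M \<times> A"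
    using sets.sets_into_space[OF A] by (auto simp: space_pair_measure)
  with A show "emeasure (distr (M \<Otimes>\<^sub>M N) N snd) A = emeasure N A"
    by (simp add: emeasure_distr N.emeasure_pair_measure_Times emeasure_space_1)
qed simp

text \<open>Meant for coordinate projections \<open>X\<close>, whose law is a factor or marginal
  \<open>N\<close>: moment bounds lift from the coordinates to the whole space.\<close>

lemma all_moments_distr:
  assumes "all_moments N f" "X \<in> measurable M N" "distr M N X = N"
  shows "all_moments M (\<lambda>x. f (X x))"
proof -
  have f: "f \<in> borel_measurable N" using assms by (auto simp: all_moments_def)
  have "integrable (distr M N X) (\<lambda>x. \<bar>f x\<bar> ^ n)" for n
    using assms by (simp add: all_moments_def)
  then show ?thesis
    using assms(2) f by (auto simp: all_moments_def intro: integrable_distr)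
qed

lemma all_moments_fst:
  assumes "prob_space M" "prob_space N" "all_moments M f"
  shows "all_moments (M \<Otimes>\<^sub>M N) (\<lambda>x. f (fst x))"
  using assms by (intro all_moments_distr[OF assms(3)]) (auto simp: prob_space.distr_pair_fst)

lemma all_moments_snd:
  assumes "prob_space M" "prob_space N" "all_moments N f"
  shows "all_moments (M \<Otimes>\<^sub>M N) (\<lambda>x. f (snd x))"
  using assms by (intro all_moments_distr[OF assms(3)])
    (auto simp: prob_space.distr_pair_snd prob_space_imp_sigma_finite)

lemma integral_pair_mult:
  fixes f :: "'a \<Rightarrow> real" and g :: "'b \<Rightarrow> real"
  assumes M: "prob_space M" and N: "prob_space N"
    and f: "integrable M f" and g: "integrable N g"
  shows "(LINT x|(M \<Otimes>\<^sub>M N). f (fst x) * g (snd x)) = (LINT x|M. f x) * (LINT y|N. g y)"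
proof -
  interpret pair_sigma_finite M N
    using M N by (simp add: pair_sigma_finite_def prob_space_imp_sigma_finite)
  have [measurable]: "f \<in> borel_measurable M" "g \<in> borel_measurable N"
    using f g by auto
  have "integrable (M \<Otimes>\<^sub>M N) (\<lambda>x. f (fst x) * g (snd x))"
    using f g by (intro Fubini_integrable) (auto simp: abs_mult)
  from integral_fst'[OF this] show ?thesis by simp
qed

subsection \<open>Change of variables\<close>

lemma nn_integral_pair_measure:
  assumes "sigma_finite_measure N" and f: "f \<in> borel_measurable (M \<Otimes>\<^sub>M N)"
  shows "integral\<^sup>N (M \<Otimes>\<^sub>M N) f = (\<integral>\<^sup>+x. \<integral>\<^sup>+y. f (x, y) \<partial>N \<partial>M)"
  using sigma_finite_measure.nn_integral_fst[OF assms(1) f] by simp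

lemma nn_integral_lborel_shift:
  fixes f :: "real \<Rightarrow> ennreal"
  assumes "f \<in> borel_measurable borel"
  shows "(\<integral>\<^sup>+x. f (x + t) \<partial>lborel) = integral\<^sup>N lborel f"
  using nn_integral_real_affine[OF assms, of 1 t] by (simp add: add.commute)

lemma nn_integral_lborel_uminus:
  fixes f :: "real \<Rightarrow> ennreal"
  assumes "f \<in> borel_measurable borel"
  shows "(\<integral>\<^sup>+x. f (- x) \<partial>lborel) = integral\<^sup>N lborel f"
  using nn_integral_real_affine[OF assms, of "-1" 0] by simp

text \<open>The translations of \<open>a\<close> and \<open>b\<close> below depend on
  \<open>z\<close> and \<open>s\<close>, so these two must be fixed first, by the outer integrals.
  Each step exchanges one adjacent pair.\<close>

lemma nn_integral_lborel4_reorder: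
  fixes F :: "real \<times> real \<times> real \<times> real \<Rightarrow> ennreal"
  assumes [measurable]: "F \<in> borel_measurable (borel \<Otimes>\<^sub>M borel \<Otimes>\<^sub>M borel \<Otimes>\<^sub>M borel)"
  shows "(\<integral>\<^sup>+a. \<integral>\<^sup>+b. \<integral>\<^sup>+s. \<integral>\<^sup>+z. F (a, b, s, z) \<partial>lborel \<partial>lborel \<partial>lborel \<partial>lborel) =
    (\<integral>\<^sup>+z. \<integral>\<^sup>+s. \<integral>\<^sup>+a. \<integral>\<^sup>+b. F (a, b, s, z) \<partial>lborel \<partial>lborel \<partial>lborel \<partial>lborel)" (is "?L = ?R")
proof -
  have "?L = (\<integral>\<^sup>+a. \<integral>\<^sup>+b. \<integral>\<^sup>+z. \<integral>\<^sup>+s. F (a, b, s, z) \<partial>lborel \<partial>lborel \<partial>lborel \<partial>lborel)"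
    by (intro nn_integral_cong lborel_pair.Fubini') measurable
  also have "\<dots> = (\<integral>\<^sup>+a. \<integral>\<^sup>+z. \<integral>\<^sup>+b. \<integral>\<^sup>+s. F (a, b, s, z) \<partial>lborel \<partial>lborel \<partial>lborel \<partial>lborel)"
    by (intro nn_integral_cong lborel_pair.Fubini') measurable
  also have "\<dots> = (\<integral>\<^sup>+z. \<integral>\<^sup>+a. \<integral>\<^sup>+b. \<integral>\<^sup>+s. F (a, b, s, z) \<partial>lborel \<partial>lborel \<partial>lborel \<partial>lborel)"
    by (intro lborel_pair.Fubini') measurable
  also have "\<dots> = (\<integral>\<^sup>+z. \<integral>\<^sup>+a. \<integral>\<^sup>+s. \<integral>\<^sup>+b. F (a, b, s, z) \<partial>lborel \<partial>lborel \<partial>lborel \<partial>lborel)"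
    by (intro nn_integral_cong lborel_pair.Fubini') measurable
  also have "\<dots> = ?R"
    by (intro nn_integral_cong lborel_pair.Fubini') measurable
  finally show ?thesis .
qed

text \<open>Restores the order of the factors of the law of \<open>(z, u, v, s)\<close> once the
  translations are done.\<close>

lemma nn_integral_lborel4_inner:
  fixes F :: "real \<times> real \<times> real \<times> real \<Rightarrow> ennreal"
  assumes [measurable]: "F \<in> borel_measurable (borel \<Otimes>\<^sub>M borel \<Otimes>\<^sub>M borel \<Otimes>\<^sub>M borel)"
  shows "(\<integral>\<^sup>+z. \<integral>\<^sup>+s. \<integral>\<^sup>+u. \<integral>\<^sup>+v. F (z, u, v, s) \<partial>lborel \<partial>lborel \<partial>lborel \<partial>lborel) =
    (\<integral>\<^sup>+z. \<integral>\<^sup>+u. \<integral>\<^sup>+v. \<integral>\<^sup>+s. F (z, u, v, s) \<partial>lborel \<partial>lborel \<partial>lborel \<partial>lborel)" (is "?L = ?R")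
proof -
  have "?L = (\<integral>\<^sup>+z. \<integral>\<^sup>+u. \<integral>\<^sup>+s. \<integral>\<^sup>+v. F (z, u, v, s) \<partial>lborel \<partial>lborel \<partial>lborel \<partial>lborel)"
    by (intro nn_integral_cong lborel_pair.Fubini') measurable
  also have "\<dots> = ?R"
    by (intro nn_integral_cong lborel_pair.Fubini') measurable
  finally show ?thesis .
qed

text \<open>The linear substitution is a shear, with determinant 1: for fixed \<open>z\<close> and
  \<open>s\<close> it merely translates \<open>a\<close> and \<open>b\<close>.\<close>

lemma nn_integral_collision_pos:
  fixes F :: "real \<times> real \<times> real \<times> real \<Rightarrow> ennreal"
  assumes [measurable]: "F \<in> borel_measurable (borel \<Otimes>\<^sub>M borel \<Otimes>\<^sub>M borel \<Otimes>\<^sub>M borel)"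
  shows "(\<integral>\<^sup>+a. \<integral>\<^sup>+b. \<integral>\<^sup>+s. \<integral>\<^sup>+z. F (a, b, s, z) \<partial>lborel \<partial>lborel \<partial>lborel \<partial>lborel) =
    (\<integral>\<^sup>+z. \<integral>\<^sup>+u. \<integral>\<^sup>+v. \<integral>\<^sup>+s. F (u + (z + s), v + z, s, z) \<partial>lborel \<partial>lborel \<partial>lborel \<partial>lborel)"
proof -
  have "(\<integral>\<^sup>+z. \<integral>\<^sup>+s. \<integral>\<^sup>+a. \<integral>\<^sup>+b. F (a, b, s, z) \<partial>lborel \<partial>lborel \<partial>lborel \<partial>lborel) =
      (\<integral>\<^sup>+z. \<integral>\<^sup>+s. \<integral>\<^sup>+u. \<integral>\<^sup>+b. F (u + (z + s), b, s, z) \<partial>lborel \<partial>lborel \<partial>lborel \<partial>lborel)"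
    by (intro nn_integral_cong nn_integral_lborel_shift[symmetric]) measurable
  also have "\<dots> =
      (\<integral>\<^sup>+z. \<integral>\<^sup>+s. \<integral>\<^sup>+u. \<integral>\<^sup>+v. F (u + (z + s), v + z, s, z) \<partial>lborel \<partial>lborel \<partial>lborel \<partial>lborel)"
    by (intro nn_integral_cong nn_integral_lborel_shift[symmetric]) measurable
  finally show ?thesis
    unfolding nn_integral_lborel4_reorder[OF assms]
    using nn_integral_lborel4_inner[of "\<lambda>(z, u, v, s). F (u + (z + s), v + z, s, z)"] by simp
qed

text \<open>As for positive jumps, after the reflection of \<open>s\<close> that makes the
  transferred amount positive.\<close>

lemma nn_integral_collision_neg:
  fixes F :: "real \<times> real \<times> real \<times> real \<Rightarrow> ennreal"
  assumes [measurable]: "F \<in> borel_measurable (borel \<Otimes>\<^sub>M borel \<Otimes>\<^sub>M borel \<Otimes>\<^sub>M borel)"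
  shows "(\<integral>\<^sup>+a. \<integral>\<^sup>+b. \<integral>\<^sup>+s. \<integral>\<^sup>+z. F (a, b, s, z) \<partial>lborel \<partial>lborel \<partial>lborel \<partial>lborel) =
    (\<integral>\<^sup>+z. \<integral>\<^sup>+u. \<integral>\<^sup>+v. \<integral>\<^sup>+s. F (u + z, v + (z + s), - s, z) \<partial>lborel \<partial>lborel \<partial>lborel \<partial>lborel)"
proof -
  have "(\<integral>\<^sup>+z. \<integral>\<^sup>+s. \<integral>\<^sup>+a. \<integral>\<^sup>+b. F (a, b, s, z) \<partial>lborel \<partial>lborel \<partial>lborel \<partial>lborel) =
      (\<integral>\<^sup>+z. \<integral>\<^sup>+s. \<integral>\<^sup>+a. \<integral>\<^sup>+b. F (a, b, - s, z) \<partial>lborel \<partial>lborel \<partial>lborel \<partial>lborel)"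
    by (intro nn_integral_cong nn_integral_lborel_uminus[symmetric]) measurable
  also have "\<dots> =
      (\<integral>\<^sup>+z. \<integral>\<^sup>+s. \<integral>\<^sup>+u. \<integral>\<^sup>+b. F (u + z, b, - s, z) \<partial>lborel \<partial>lborel \<partial>lborel \<partial>lborel)"
    by (intro nn_integral_cong nn_integral_lborel_shift[symmetric]) measurable
  also have "\<dots> =
      (\<integral>\<^sup>+z. \<integral>\<^sup>+s. \<integral>\<^sup>+u. \<integral>\<^sup>+v. F (u + z, v + (z + s), - s, z) \<partial>lborel \<partial>lborel \<partial>lborel \<partial>lborel)"
    by (intro nn_integral_cong nn_integral_lborel_shift[symmetric]) measurable
  finally show ?thesis
    unfolding nn_integral_lborel4_reorder[OF assms]
    using nn_integral_lborel4_inner[of "\<lambda>(z, u, v, s). F (u + z, v + (z + s), - s, z)"] by simp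
qed

lemma pred_in_interval [measurable (raw)]:
  fixes f g h :: "'a \<Rightarrow> real"
  assumes [measurable]: "f \<in> borel_measurable M" "g \<in> borel_measurable M" "h \<in> borel_measurable M"
  shows "Measurable.pred M (\<lambda>x. h x \<in> {f x<..<g x})"
  unfolding greaterThanLessThan_iff by measurable

subsection \<open>The collision law\<close>

text \<open>The power part of a Gamma density, indexed by its shape. Being 0 off the positive
  half-line, it carries the constraints \<open>0 < z\<close>, \<open>z < u\<close>,
  \<open>z < v\<close> of the mixture, so that integrals run over the whole line.\<close>

definition pos_powr :: "real \<Rightarrow> real \<Rightarrow> real" where
  "pos_powr a t = (if 0 < t then t powr (a - 1) else 0)"

lemma measurable_pos_powr [measurable]: "pos_powr a \<in> borel_measurable borel"
  unfolding pos_powr_def by measurable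

lemma pos_powr_nonneg [simp]: "0 \<le> pos_powr a t"
  by (simp add: pos_powr_def)

lemma gamma_density_eq:
  "gamma_density a c t = c powr a / Gamma a * (pos_powr a t * exp (- (c * t)))"
  by (simp add: gamma_density_def pos_powr_def)

text \<open>
  Both kernels are mixtures over a hidden variable \<open>z\<close>: an energy below all four energies of the
  collision.
\<close>

definition collision_weight :: "real \<Rightarrow> real \<Rightarrow> real \<Rightarrow> ennreal" where
  "collision_weight \<beta> u v =
     (\<integral>\<^sup>+z. ennreal (pos_powr (1/2) z * pos_powr \<beta> (u - z) * pos_powr \<beta> (v - z)) \<partial>lborel)"

lemma measurable_collision_weight [measurable (raw)]:
  assumes [measurable]: "f \<in> borel_measurable M" "g \<in> borel_measurable M"
  shows "(\<lambda>x. collision_weight \<beta> (f x) (g x)) \<in> borel_measurable M"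
  unfolding collision_weight_def by measurable

lemma collision_weight_eq_0: "u \<le> 0 \<or> v \<le> 0 \<Longrightarrow> collision_weight \<beta> u v = 0"
  unfolding collision_weight_def
  by (subst nn_integral_cong[where v = "\<lambda>_. 0"]) (auto simp: pos_powr_def)

text \<open>At each site consider the smaller of the energies before and after the jump:
  \<open>a - \<eta>\<close> and \<open>b\<close> for positive \<eta>, \<open>a\<close> and
  \<open>b + \<eta>\<close> for negative \<eta>. Once weighted with the power parts of both
  equilibrium densities, the rate is a function of these two energies alone. At
  \<open>\<eta> = a - b\<close> the two energies agree; there the kernels only have a default value,
  and the elliptic mixture diverges.\<close>

locale collision_kernel =
  fixes W :: kernel and d :: nat and \<beta> c :: real
  assumes beta_pos: "0 < \<beta>" and c_pos: "0 < c" and dim: "real d / 2 = \<beta> + 1/2"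
    and kernel_measurable: "(\<lambda>(a, b, \<eta>). W a b \<eta>) \<in> borel_measurable (borel \<Otimes>\<^sub>M borel \<Otimes>\<^sub>M borel)"
    and kernel_nonneg: "\<And>a b \<eta>. 0 < a \<Longrightarrow> 0 < b \<Longrightarrow> - b < \<eta> \<Longrightarrow> \<eta> < a \<Longrightarrow> 0 \<le> W a b \<eta>"
    and kernel_pos: "\<And>a b \<eta>. 0 < a \<Longrightarrow> 0 < b \<Longrightarrow> 0 < \<eta> \<Longrightarrow> \<eta> < a \<Longrightarrow> \<eta> \<noteq> a - b \<Longrightarrow>
      ennreal (pos_powr (\<beta> + 1/2) a * pos_powr (\<beta> + 1/2) b * W a b \<eta>) =
      ennreal c * collision_weight \<beta> (a - \<eta>) b"
    and kernel_neg: "\<And>a b \<eta>. 0 < a \<Longrightarrow> 0 < b \<Longrightarrow> - b < \<eta> \<Longrightarrow> \<eta> < 0 \<Longrightarrow> \<eta> \<noteq> a - b \<Longrightarrow>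
      ennreal (pos_powr (\<beta> + 1/2) a * pos_powr (\<beta> + 1/2) b * W a b \<eta>) =
      ennreal c * collision_weight \<beta> a (b + \<eta>)"
begin

lemma measurable_kernel [measurable (raw)]:
  assumes [measurable]: "f \<in> borel_measurable M" "g \<in> borel_measurable M" "h \<in> borel_measurable M"
  shows "(\<lambda>x. W (f x) (g x) (h x)) \<in> borel_measurable M"
proof -
  have "(\<lambda>x. (\<lambda>(a, b, \<eta>). W a b \<eta>) (f x, g x, h x)) \<in> borel_measurable M"
    by (rule measurable_compose[OF _ kernel_measurable]) measurable
  then show ?thesis by simp
qed

definition energy_law :: "real measure" where
  "energy_law = gamma_law (\<beta> + 1/2) 1"

definition collision_law :: "(real \<times> real \<times> real \<times> real) measure" where
  "collision_law = gamma_law (1/2) 2 \<Otimes>\<^sub>M gamma_law \<beta> 1 \<Otimes>\<^sub>M gamma_law \<beta> 1 \<Otimes>\<^sub>M gamma_law 1 1"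

definition jump_pos :: "real \<times> real \<times> real \<times> real \<Rightarrow> real \<times> real \<times> real" where
  "jump_pos = (\<lambda>(z, u, v, s). (u + (z + s), v + z, s))"

definition jump_neg :: "real \<times> real \<times> real \<times> real \<Rightarrow> real \<times> real \<times> real" where
  "jump_neg = (\<lambda>(z, u, v, s). (u + z, v + (z + s), - s))"

text \<open>A quotient of normalizing constants: \<open>c / (Gamma (\<beta> + 1/2))\<^sup>2\<close>
  stems from the two energy densities, while \<open>Gamma (1/2) / sqrt 2\<close> and
  \<open>(Gamma \<beta>)\<^sup>2\<close> normalize the laws of \<open>z\<close> and of
  \<open>u\<close>, \<open>v\<close>. The density of \<open>s\<close> has constant 1.\<close>

definition rate_const :: real where
  "rate_const = c * Gamma (1/2) * (Gamma \<beta>)\<^sup>2 / (sqrt 2 * (Gamma (\<beta> + 1/2))\<^sup>2)"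

lemma Gamma_pos: "0 < Gamma \<beta>" "0 < Gamma (\<beta> + 1/2)" "0 < Gamma (1/2 :: real)"
  using beta_pos by (auto intro!: Gamma_real_pos)

lemma rate_const_pos: "0 < rate_const"
  unfolding rate_const_def using c_pos Gamma_pos
  by (intro divide_pos_pos mult_pos_pos zero_less_power) auto

lemma prob_space_energy_law: "prob_space energy_law"
  unfolding energy_law_def using beta_pos by (intro prob_space_gamma_law) auto

lemma prob_space_collision_law: "prob_space collision_law"
  unfolding collision_law_def using beta_pos by (intro prob_space_pair prob_space_gamma_law) auto

lemma sets_energy_law [simp, measurable_cong]: "sets energy_law = sets borel"
  by (simp add: energy_law_def)

lemma sets_collision_law [measurable_cong]:
  "sets collision_law = sets (borel \<Otimes>\<^sub>M borel \<Otimes>\<^sub>M borel \<Otimes>\<^sub>M borel)"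
  unfolding collision_law_def by (intro sets_pair_measure_cong) auto

lemma measurable_jumps [measurable]:
  "jump_pos \<in> measurable collision_law (borel \<Otimes>\<^sub>M borel \<Otimes>\<^sub>M borel)"
  "jump_neg \<in> measurable collision_law (borel \<Otimes>\<^sub>M borel \<Otimes>\<^sub>M borel)"
  unfolding jump_pos_def jump_neg_def by measurable

lemma nn_integral_collision_law:
  assumes [measurable]: "F \<in> borel_measurable (borel \<Otimes>\<^sub>M borel \<Otimes>\<^sub>M borel \<Otimes>\<^sub>M borel)"
  shows "integral\<^sup>N collision_law F =
    (\<integral>\<^sup>+z. \<integral>\<^sup>+u. \<integral>\<^sup>+v. \<integral>\<^sup>+s. ennreal (gamma_density (1/2) 2 z * gamma_density \<beta> 1 u *
       gamma_density \<beta> 1 v * gamma_density 1 1 s) * F (z, u, v, s) \<partial>lborel \<partial>lborel \<partial>lborel \<partial>lborel)"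
proof -
  have P: "prob_space (gamma_law \<beta> 1)" "prob_space (gamma_law 1 1)"
    using beta_pos by (auto intro!: prob_space_gamma_law)
  have nn: "0 \<le> gamma_density \<beta> 1 x" "0 \<le> gamma_density 1 1 x" "0 \<le> gamma_density (1/2) 2 x" for x
    using beta_pos by (auto intro!: gamma_density_nonneg)
  show ?thesis
    unfolding collision_law_def
    by (simp add: nn_integral_pair_measure prob_space_imp_sigma_finite prob_space_pair P nn_integral_gamma_law ennreal_mult nn
        nn_integral_cmult[symmetric] mult.assoc)
qed

text \<open>Outside the admissible region the left side vanishes through its densities and its
  indicator, the right side because some argument of \<open>collision_weight\<close> is not
  positive. The right side thus carries the support implicitly, and variables can be changed on the
  whole space.\<close>

lemma kernel_eq_mixture:
  assumes "\<eta> \<noteq> 0" "\<eta> \<noteq> a - b"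
  shows "ennreal (gamma_density (\<beta> + 1/2) 1 a) * (ennreal (gamma_density (\<beta> + 1/2) 1 b) *
      (ennreal (W a b \<eta>) * indicator {- b<..<a} \<eta>)) =
    ennreal (c / (Gamma (\<beta> + 1/2))\<^sup>2 * exp (- (a + b))) *
      ((if 0 < \<eta> then collision_weight \<beta> (a - \<eta>) b else 0) +
       (if \<eta> < 0 then collision_weight \<beta> a (b + \<eta>) else 0))" (is "?L = ?R")
proof (cases "0 < a \<and> 0 < b \<and> - b < \<eta> \<and> \<eta> < a")
  case True
  then have "0 \<le> W a b \<eta>" by (simp add: kernel_nonneg)
  then have "?L = ennreal (1 / (Gamma (\<beta> + 1/2))\<^sup>2 * exp (- (a + b))) *
      ennreal (pos_powr (\<beta> + 1/2) a * pos_powr (\<beta> + 1/2) b * W a b \<eta>)"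
    using True Gamma_pos
    by (simp add: gamma_density_eq ennreal_mult[symmetric] exp_diff exp_minus field_simps
        power2_eq_square less_imp_le)
  also have "\<dots> = ennreal (1 / (Gamma (\<beta> + 1/2))\<^sup>2 * exp (- (a + b))) * (ennreal c *
      ((if 0 < \<eta> then collision_weight \<beta> (a - \<eta>) b else 0) +
       (if \<eta> < 0 then collision_weight \<beta> a (b + \<eta>) else 0)))"
    using True assms by (cases "0 < \<eta>") (auto simp: kernel_pos kernel_neg)
  also have "\<dots> = ?R"
    using c_pos by (simp add: mult.assoc[symmetric] ennreal_mult[symmetric] mult_ac)
  finally show ?thesis .
next
  case False
  have "?L = 0" using False by (auto simp: gamma_density_def indicator_def)
  moreover have "?R = 0"
    using False by (auto simp: collision_weight_eq_0)
  ultimately show ?thesis by (simp only:)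
qed

lemma nn_integral_jumps:
  assumes [measurable]: "G \<in> borel_measurable (borel \<Otimes>\<^sub>M borel \<Otimes>\<^sub>M borel)"
  shows "(\<integral>\<^sup>+a. \<integral>\<^sup>+b. \<integral>\<^sup>+\<eta>. (ennreal (W a b \<eta>) * indicator {- b<..<a} \<eta>) * G (a, b, \<eta>)
      \<partial>lborel \<partial>energy_law \<partial>energy_law) =
    ennreal rate_const *
      ((\<integral>\<^sup>+\<omega>. G (jump_pos \<omega>) \<partial>collision_law) + (\<integral>\<^sup>+\<omega>. G (jump_neg \<omega>) \<partial>collision_law))"
proof -
  let ?g = "gamma_density (\<beta> + 1/2) 1"
  let ?k = "c / (Gamma (\<beta> + 1/2))\<^sup>2"
  \<comment> \<open>The integrands with the hidden \<open>z\<close> kept as a fourth coordinate, one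
    for each sign of the jump.\<close>
  define Kp :: "real \<times> real \<times> real \<times> real \<Rightarrow> ennreal" where
    "Kp = (\<lambda>(a, b, \<eta>, z). ennreal (?k * exp (- (a + b)) * (if 0 < \<eta> then 1 else 0) *
        (pos_powr (1/2) z * pos_powr \<beta> (a - \<eta> - z) * pos_powr \<beta> (b - z))) * G (a, b, \<eta>))"
  define Kn :: "real \<times> real \<times> real \<times> real \<Rightarrow> ennreal" where
    "Kn = (\<lambda>(a, b, \<eta>, z). ennreal (?k * exp (- (a + b)) * (if \<eta> < 0 then 1 else 0) *
        (pos_powr (1/2) z * pos_powr \<beta> (a - z) * pos_powr \<beta> (b + \<eta> - z))) * G (a, b, \<eta>))"
  have [measurable]: "Kp \<in> borel_measurable (borel \<Otimes>\<^sub>M borel \<Otimes>\<^sub>M borel \<Otimes>\<^sub>M borel)"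
    "Kn \<in> borel_measurable (borel \<Otimes>\<^sub>M borel \<Otimes>\<^sub>M borel \<Otimes>\<^sub>M borel)"
    unfolding Kp_def Kn_def by measurable
  have k: "0 \<le> ?k" using c_pos by simp
  have inner: "(\<integral>\<^sup>+\<eta>. ennreal (?g a) * (ennreal (?g b) *
        ((ennreal (W a b \<eta>) * indicator {- b<..<a} \<eta>) * G (a, b, \<eta>))) \<partial>lborel) =
      (\<integral>\<^sup>+\<eta>. \<integral>\<^sup>+z. Kp (a, b, \<eta>, z) + Kn (a, b, \<eta>, z) \<partial>lborel \<partial>lborel)" for a b
  proof (rule nn_integral_cong_AE)
    \<comment> \<open>The null set on which \<open>kernel_eq_mixture\<close> says nothing.\<close>
    have "AE \<eta> in lborel. \<eta> \<noteq> (0::real) \<and> \<eta> \<noteq> a - b"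
      using AE_lborel_singleton[of "0::real"] AE_lborel_singleton[of "a - b"] by eventually_elim auto
    then show "AE \<eta> in lborel. ennreal (?g a) * (ennreal (?g b) *
        ((ennreal (W a b \<eta>) * indicator {- b<..<a} \<eta>) * G (a, b, \<eta>))) =
        (\<integral>\<^sup>+z. Kp (a, b, \<eta>, z) + Kn (a, b, \<eta>, z) \<partial>lborel)"
    proof eventually_elim
      case (elim \<eta>)
      have "ennreal (?g a) * (ennreal (?g b) *
          ((ennreal (W a b \<eta>) * indicator {- b<..<a} \<eta>) * G (a, b, \<eta>))) =
          ennreal (?g a) * (ennreal (?g b) *
          (ennreal (W a b \<eta>) * indicator {- b<..<a} \<eta>)) * G (a, b, \<eta>)"
        by (simp add: mult_ac)
      also have "\<dots> = ennreal (?k * exp (- (a + b))) *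
          ((if 0 < \<eta> then collision_weight \<beta> (a - \<eta>) b else 0) +
           (if \<eta> < 0 then collision_weight \<beta> a (b + \<eta>) else 0)) * G (a, b, \<eta>)"
        using elim by (subst kernel_eq_mixture) auto
      also have "\<dots> = (\<integral>\<^sup>+z. Kp (a, b, \<eta>, z) \<partial>lborel) + (\<integral>\<^sup>+z. Kn (a, b, \<eta>, z) \<partial>lborel)"
      proof -
        define h where "h = ?k * exp (- (a + b))"
        have h: "0 \<le> h" using c_pos by (simp add: h_def)
        have "Kp (a, b, \<eta>, z) = ennreal h * (if 0 < \<eta> then 1 else 0) *
            ennreal (pos_powr (1/2) z * pos_powr \<beta> (a - \<eta> - z) * pos_powr \<beta> (b - z)) * G (a, b, \<eta>)"
          and "Kn (a, b, \<eta>, z) = ennreal h * (if \<eta> < 0 then 1 else 0) *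
            ennreal (pos_powr (1/2) z * pos_powr \<beta> (a - z) * pos_powr \<beta> (b + \<eta> - z)) * G (a, b, \<eta>)" for z
          using h unfolding Kp_def Kn_def prod.case h_def[symmetric] by (auto simp: ennreal_mult)
        then show ?thesis
          unfolding collision_weight_def h_def[symmetric]
          by (simp add: nn_integral_cmult nn_integral_multc distrib_left distrib_right)
      qed
      also have "\<dots> = (\<integral>\<^sup>+z. Kp (a, b, \<eta>, z) + Kn (a, b, \<eta>, z) \<partial>lborel)"
        by (rule nn_integral_add[symmetric]) measurable
      finally show ?case .
    qed
  qed
  have "(\<integral>\<^sup>+a. \<integral>\<^sup>+b. \<integral>\<^sup>+\<eta>. (ennreal (W a b \<eta>) * indicator {- b<..<a} \<eta>) * G (a, b, \<eta>)
      \<partial>lborel \<partial>energy_law \<partial>energy_law) =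
    (\<integral>\<^sup>+a. \<integral>\<^sup>+b. \<integral>\<^sup>+\<eta>. ennreal (?g a) * (ennreal (?g b) *
        ((ennreal (W a b \<eta>) * indicator {- b<..<a} \<eta>) * G (a, b, \<eta>))) \<partial>lborel \<partial>lborel \<partial>lborel)"
  proof -
    have "(\<integral>\<^sup>+b. \<integral>\<^sup>+\<eta>. (ennreal (W a b \<eta>) * indicator {- b<..<a} \<eta>) * G (a, b, \<eta>) \<partial>lborel \<partial>energy_law) =
        (\<integral>\<^sup>+b. \<integral>\<^sup>+\<eta>. ennreal (?g b) * ((ennreal (W a b \<eta>) * indicator {- b<..<a} \<eta>) * G (a, b, \<eta>))
          \<partial>lborel \<partial>lborel)" for a
      unfolding energy_law_def by (subst nn_integral_gamma_law) (auto simp: nn_integral_cmult)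
    then show ?thesis
      unfolding energy_law_def by (subst nn_integral_gamma_law) (auto simp: nn_integral_cmult)
  qed
  also have "\<dots> = (\<integral>\<^sup>+a. \<integral>\<^sup>+b. \<integral>\<^sup>+\<eta>. \<integral>\<^sup>+z. Kp (a, b, \<eta>, z) + Kn (a, b, \<eta>, z)
      \<partial>lborel \<partial>lborel \<partial>lborel \<partial>lborel)"
    unfolding inner ..
  also have "\<dots> = (\<integral>\<^sup>+a. \<integral>\<^sup>+b. \<integral>\<^sup>+\<eta>. \<integral>\<^sup>+z. Kp (a, b, \<eta>, z) \<partial>lborel \<partial>lborel \<partial>lborel \<partial>lborel) +
      (\<integral>\<^sup>+a. \<integral>\<^sup>+b. \<integral>\<^sup>+\<eta>. \<integral>\<^sup>+z. Kn (a, b, \<eta>, z) \<partial>lborel \<partial>lborel \<partial>lborel \<partial>lborel)"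
    by (simp add: nn_integral_add)
  also have "(\<integral>\<^sup>+a. \<integral>\<^sup>+b. \<integral>\<^sup>+\<eta>. \<integral>\<^sup>+z. Kp (a, b, \<eta>, z) \<partial>lborel \<partial>lborel \<partial>lborel \<partial>lborel) =
      (\<integral>\<^sup>+z. \<integral>\<^sup>+u. \<integral>\<^sup>+v. \<integral>\<^sup>+s. ennreal rate_const * (ennreal (gamma_density (1/2) 2 z *
        gamma_density \<beta> 1 u * gamma_density \<beta> 1 v * gamma_density 1 1 s) * G (jump_pos (z, u, v, s)))
        \<partial>lborel \<partial>lborel \<partial>lborel \<partial>lborel)"
    (is "_ = (\<integral>\<^sup>+z. \<integral>\<^sup>+u. \<integral>\<^sup>+v. \<integral>\<^sup>+s. ?P z u v s \<partial>lborel \<partial>lborel \<partial>lborel \<partial>lborel)")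
  proof (subst nn_integral_collision_pos, measurable, intro nn_integral_cong)
    fix z u v s :: real
    \<comment> \<open>Here \<open>a + b = u + v + 2 * z + s\<close>, so the exponential factorizes,
      with rate 2 for \<open>z\<close> because \<open>z\<close> sits in both sites. No power of
      \<open>s\<close> occurs, which makes \<open>s\<close> a unit exponential.\<close>
    have "ennreal (?k * exp (- (u + (z + s) + (v + z))) * (if 0 < s then 1 else 0) *
        (pos_powr (1/2) z * pos_powr \<beta> (u + (z + s) - s - z) * pos_powr \<beta> (v + z - z))) =
        ennreal (rate_const * (gamma_density (1/2) 2 z * gamma_density \<beta> 1 u * gamma_density \<beta> 1 v *
          gamma_density 1 1 s))"
      using Gamma_pos unfolding gamma_density_eq rate_const_def
      by (intro arg_cong[where f = ennreal])
        (auto simp: pos_powr_def Gamma_one_half_real powr_half_sqrt exp_add[symmetric] field_simps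
          power2_eq_square exp_minus)
    then show "Kp (u + (z + s), v + z, s, z) = ?P z u v s"
      unfolding Kp_def jump_pos_def prod.case
      by (simp only: ennreal_mult'[OF less_imp_le[OF rate_const_pos]] mult.assoc)
  qed
  also have "\<dots> = ennreal rate_const * (\<integral>\<^sup>+\<omega>. G (jump_pos \<omega>) \<partial>collision_law)"
    by (simp add: nn_integral_cmult nn_integral_collision_law)
  also have "(\<integral>\<^sup>+a. \<integral>\<^sup>+b. \<integral>\<^sup>+\<eta>. \<integral>\<^sup>+z. Kn (a, b, \<eta>, z) \<partial>lborel \<partial>lborel \<partial>lborel \<partial>lborel) =
      (\<integral>\<^sup>+z. \<integral>\<^sup>+u. \<integral>\<^sup>+v. \<integral>\<^sup>+s. ennreal rate_const * (ennreal (gamma_density (1/2) 2 z *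
        gamma_density \<beta> 1 u * gamma_density \<beta> 1 v * gamma_density 1 1 s) * G (jump_neg (z, u, v, s)))
        \<partial>lborel \<partial>lborel \<partial>lborel \<partial>lborel)"
    (is "_ = (\<integral>\<^sup>+z. \<integral>\<^sup>+u. \<integral>\<^sup>+v. \<integral>\<^sup>+s. ?N z u v s \<partial>lborel \<partial>lborel \<partial>lborel \<partial>lborel)")
  proof (subst nn_integral_collision_neg, measurable, intro nn_integral_cong)
    fix z u v s :: real
    have "ennreal (?k * exp (- (u + z + (v + (z + s)))) * (if - s < 0 then 1 else 0) *
        (pos_powr (1/2) z * pos_powr \<beta> (u + z - z) * pos_powr \<beta> (v + (z + s) + - s - z))) =
        ennreal (rate_const * (gamma_density (1/2) 2 z * gamma_density \<beta> 1 u * gamma_density \<beta> 1 v *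
          gamma_density 1 1 s))"
      using Gamma_pos unfolding gamma_density_eq rate_const_def
      by (intro arg_cong[where f = ennreal])
        (auto simp: pos_powr_def Gamma_one_half_real powr_half_sqrt exp_add[symmetric] field_simps
          power2_eq_square exp_minus)
    then show "Kn (u + z, v + (z + s), - s, z) = ?N z u v s"
      unfolding Kn_def jump_neg_def prod.case
      by (simp only: ennreal_mult'[OF less_imp_le[OF rate_const_pos]] mult.assoc)
  qed
  also have "\<dots> = ennreal rate_const * (\<integral>\<^sup>+\<omega>. G (jump_neg \<omega>) \<partial>collision_law)"
    by (simp add: nn_integral_cmult nn_integral_collision_law)
  finally show ?thesis by (simp add: distrib_left)
qed

end

subsection \<open>Marginals of the equilibrium\<close>

text \<open>Four sites are what the gradient of the trial function sees: the bond 0, 1 and its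
  neighbours -1, 2. Restriction leads to a finite product, which is peeled one coordinate at a
  time.\<close>

lemma distr_PiM_four:
  fixes i j k l :: 'i
  assumes M: "prob_space M" and dist: "distinct [i, j, k, l]"
  shows "distr (PiM UNIV (\<lambda>_. M)) (M \<Otimes>\<^sub>M M \<Otimes>\<^sub>M M \<Otimes>\<^sub>M M) (\<lambda>x. (x i, x j, x k, x l)) =
    M \<Otimes>\<^sub>M M \<Otimes>\<^sub>M M \<Otimes>\<^sub>M M"
proof (rule measure_eqI)
  interpret product_prob_space "\<lambda>_::'i. M" UNIV
    using M by (simp add: product_prob_space_def product_prob_space_axioms_def
        product_sigma_finite_def prob_space_imp_sigma_finite)
  have sf: "sigma_finite_measure M" using M by (rule prob_space_imp_sigma_finite)
  have sf2: "sigma_finite_measure (M \<Otimes>\<^sub>M M)" "sigma_finite_measure (M \<Otimes>\<^sub>M M \<Otimes>\<^sub>M M)"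
    using M by (auto intro!: prob_space_imp_sigma_finite prob_space_pair)
  let ?J = "{i, j, k, l}"
  fix A assume "A \<in> sets (distr (PiM UNIV (\<lambda>_. M)) (M \<Otimes>\<^sub>M M \<Otimes>\<^sub>M M \<Otimes>\<^sub>M M) (\<lambda>x. (x i, x j, x k, x l)))"
  then have [measurable]: "A \<in> sets (M \<Otimes>\<^sub>M M \<Otimes>\<^sub>M M \<Otimes>\<^sub>M M)" by simp
  define F :: "'a \<times> 'a \<times> 'a \<times> 'a \<Rightarrow> ennreal" where "F = indicator A"
  have F [measurable]: "F \<in> borel_measurable (M \<Otimes>\<^sub>M M \<Otimes>\<^sub>M M \<Otimes>\<^sub>M M)"
    unfolding F_def by measurable
  have "emeasure (distr (PiM UNIV (\<lambda>_. M)) (M \<Otimes>\<^sub>M M \<Otimes>\<^sub>M M \<Otimes>\<^sub>M M) (\<lambda>x. (x i, x j, x k, x l))) A =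
      integral\<^sup>N (distr (PiM UNIV (\<lambda>_. M)) (M \<Otimes>\<^sub>M M \<Otimes>\<^sub>M M \<Otimes>\<^sub>M M) (\<lambda>x. (x i, x j, x k, x l))) F"
    unfolding F_def by simp
  also have "\<dots> = (\<integral>\<^sup>+x. F (x i, x j, x k, x l) \<partial>PiM UNIV (\<lambda>_. M))"
    by (subst nn_integral_distr) auto
  also have "\<dots> = (\<integral>\<^sup>+x. F (x i, x j, x k, x l) \<partial>distr (PiM UNIV (\<lambda>_. M)) (PiM ?J (\<lambda>_. M)) (\<lambda>x. restrict x ?J))"
    by (subst nn_integral_distr) auto
  also have "\<dots> = (\<integral>\<^sup>+x. F (x i, x j, x k, x l) \<partial>PiM ?J (\<lambda>_. M))"
    by (subst distr_PiM_restrict_finite) auto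
  also have "\<dots> = (\<integral>\<^sup>+p. \<integral>\<^sup>+x. F (p, x j, x k, x l) \<partial>PiM {j, k, l} (\<lambda>_. M) \<partial>M)"
    using dist by (subst product_nn_integral_insert_rev) auto
  also have "\<dots> = (\<integral>\<^sup>+p. \<integral>\<^sup>+q. \<integral>\<^sup>+x. F (p, q, x k, x l) \<partial>PiM {k, l} (\<lambda>_. M) \<partial>M \<partial>M)"
    using dist by (intro nn_integral_cong, subst product_nn_integral_insert_rev) auto
  also have "\<dots> = (\<integral>\<^sup>+p. \<integral>\<^sup>+q. \<integral>\<^sup>+a. \<integral>\<^sup>+x. F (p, q, a, x l) \<partial>PiM {l} (\<lambda>_. M) \<partial>M \<partial>M \<partial>M)"
    using dist by (intro nn_integral_cong, subst product_nn_integral_insert_rev) auto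
  also have "\<dots> = (\<integral>\<^sup>+p. \<integral>\<^sup>+q. \<integral>\<^sup>+a. \<integral>\<^sup>+b. F (p, q, a, b) \<partial>M \<partial>M \<partial>M \<partial>M)"
    by (intro nn_integral_cong product_nn_integral_singleton) auto
  also have "\<dots> = integral\<^sup>N (M \<Otimes>\<^sub>M M \<Otimes>\<^sub>M M \<Otimes>\<^sub>M M) F"
    apply (subst nn_integral_pair_measure[OF sf2(2) F])
    apply (rule nn_integral_cong, subst nn_integral_pair_measure[OF sf2(1)], simp)
    apply (rule nn_integral_cong, subst nn_integral_pair_measure[OF sf], simp_all)
    done
  also have "\<dots> = emeasure (M \<Otimes>\<^sub>M M \<Otimes>\<^sub>M M \<Otimes>\<^sub>M M) A"
    unfolding F_def by simp
  finally show "emeasure (distr (PiM UNIV (\<lambda>_. M)) (M \<Otimes>\<^sub>M M \<Otimes>\<^sub>M M \<Otimes>\<^sub>M M) (\<lambda>x. (x i, x j, x k, x l))) A =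
      emeasure (M \<Otimes>\<^sub>M M \<Otimes>\<^sub>M M \<Otimes>\<^sub>M M) A" .
qed simp

text \<open>Adjoin an auxiliary site \<open>h\<close> and project it away again.\<close>

lemma distr_PiM_three:
  fixes i j k :: int
  assumes M: "prob_space M" and dist: "distinct [i, j, k]"
  shows "distr (PiM UNIV (\<lambda>_. M)) (M \<Otimes>\<^sub>M M \<Otimes>\<^sub>M M) (\<lambda>x. (x i, x j, x k)) = M \<Otimes>\<^sub>M M \<Otimes>\<^sub>M M"
proof -
  obtain h :: int where h: "h \<notin> {i, j, k}"
    using ex_new_if_finite[of "{i, j, k}"] by (auto simp: infinite_UNIV_int)
  have sf: "sigma_finite_measure (M \<Otimes>\<^sub>M M \<Otimes>\<^sub>M M)"
    using M by (auto intro!: prob_space_imp_sigma_finite prob_space_pair)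
  have "distr (PiM UNIV (\<lambda>_. M)) (M \<Otimes>\<^sub>M M \<Otimes>\<^sub>M M) (\<lambda>x. (x i, x j, x k)) =
      distr (distr (PiM UNIV (\<lambda>_. M)) (M \<Otimes>\<^sub>M M \<Otimes>\<^sub>M M \<Otimes>\<^sub>M M) (\<lambda>x. (x h, x i, x j, x k)))
        (M \<Otimes>\<^sub>M M \<Otimes>\<^sub>M M) snd"
    by (subst distr_distr) (auto simp: comp_def)
  also have "\<dots> = M \<Otimes>\<^sub>M M \<Otimes>\<^sub>M M"
    using h dist by (subst distr_PiM_four[OF M]) (auto simp: prob_space.distr_pair_snd[OF M sf])
  finally show ?thesis .
qed

lemma distr_PiM_two:
  fixes i j :: int
  assumes M: "prob_space M" and dist: "i \<noteq> j"
  shows "distr (PiM UNIV (\<lambda>_. M)) (M \<Otimes>\<^sub>M M) (\<lambda>x. (x i, x j)) = M \<Otimes>\<^sub>M M"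
proof -
  obtain h :: int where h: "h \<notin> {i, j}"
    using ex_new_if_finite[of "{i, j}"] by (auto simp: infinite_UNIV_int)
  have sf: "sigma_finite_measure (M \<Otimes>\<^sub>M M)"
    using M by (auto intro!: prob_space_imp_sigma_finite prob_space_pair)
  have "distr (PiM UNIV (\<lambda>_. M)) (M \<Otimes>\<^sub>M M) (\<lambda>x. (x i, x j)) =
      distr (distr (PiM UNIV (\<lambda>_. M)) (M \<Otimes>\<^sub>M M \<Otimes>\<^sub>M M) (\<lambda>x. (x h, x i, x j))) (M \<Otimes>\<^sub>M M) snd"
    by (subst distr_distr) (auto simp: comp_def)
  also have "\<dots> = M \<Otimes>\<^sub>M M"
    using h dist by (subst distr_PiM_three[OF M]) (auto simp: prob_space.distr_pair_snd[OF M sf])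
  finally show ?thesis .
qed

subsection \<open>Static quantities\<close>

context collision_kernel
begin

lemma equilibrium_eq: "equilibrium d 1 = PiM UNIV (\<lambda>_. energy_law)"
proof -
  have "energy_density d 1 = gamma_density (\<beta> + 1/2) 1"
    unfolding energy_density_def gamma_density_def dim by (auto simp: fun_eq_iff)
  then show ?thesis by (simp add: equilibrium_def energy_law_def gamma_law_def)
qed

text \<open>The unnormalized joint law of the energies of a bond and the transferred amount. The
  nesting keeps both energies in the first factor, so that Fubini produces the integral over \<eta>
  that occurs in \<open>rate_moment\<close>.\<close>

definition jump_measure :: "((real \<times> real) \<times> real) measure" where
  "jump_measure = density ((energy_law \<Otimes>\<^sub>M energy_law) \<Otimes>\<^sub>M lborel)
     (\<lambda>((a, b), \<eta>). ennreal (W a b \<eta>) * indicator {- b<..<a} \<eta>)"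

lemma nn_integral_jump_measure:
  assumes [measurable]: "G \<in> borel_measurable (borel \<Otimes>\<^sub>M borel \<Otimes>\<^sub>M borel)"
  shows "(\<integral>\<^sup>+((a, b), \<eta>). G (a, b, \<eta>) \<partial>jump_measure) =
    ennreal rate_const *
      ((\<integral>\<^sup>+\<omega>. G (jump_pos \<omega>) \<partial>collision_law) + (\<integral>\<^sup>+\<omega>. G (jump_neg \<omega>) \<partial>collision_law))"
proof -
  have sf: "sigma_finite_measure energy_law"
    using prob_space_energy_law by (rule prob_space_imp_sigma_finite)
  interpret sigma_finite_measure energy_law by (rule sf)
  show ?thesis
    unfolding jump_measure_def nn_integral_jumps[OF assms, symmetric] case_prod_unfold
    apply (subst nn_integral_density)
      apply measurable
    apply (subst nn_integral_pair_measure)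
      apply (rule lborel.sigma_finite_measure_axioms)
     apply measurable
    apply (subst nn_integral_pair_measure)
      apply (rule sf)
     apply measurable
    done
qed

lemma integral_jump_measure:
  fixes f :: "real \<times> real \<times> real \<Rightarrow> real"
  assumes f [measurable]: "f \<in> borel_measurable (borel \<Otimes>\<^sub>M borel \<Otimes>\<^sub>M borel)"
    and p: "integrable collision_law (\<lambda>\<omega>. f (jump_pos \<omega>))"
    and n: "integrable collision_law (\<lambda>\<omega>. f (jump_neg \<omega>))"
  shows "integrable jump_measure (\<lambda>((a, b), \<eta>). f (a, b, \<eta>))"
    and "(LINT ((a, b), \<eta>)|jump_measure. f (a, b, \<eta>)) =
      rate_const * ((LINT \<omega>|collision_law. f (jump_pos \<omega>)) + (LINT \<omega>|collision_law. f (jump_neg \<omega>)))"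
proof -
  have sets: "sets jump_measure = sets ((borel \<Otimes>\<^sub>M borel) \<Otimes>\<^sub>M borel)"
    unfolding jump_measure_def by (simp cong: sets_pair_measure_cong)
  have m [measurable]: "(\<lambda>((a, b), \<eta>). f (a, b, \<eta>)) \<in> borel_measurable jump_measure"
    unfolding measurable_cong_sets[OF sets refl] case_prod_unfold by measurable
  \<comment> \<open>With \<open>g\<close> the identity and \<open>g\<close> the negation this gives
    the positive and the negative part, whose difference is the Bochner integral.\<close>
  have *: "(\<integral>\<^sup>+x. ennreal (g ((\<lambda>((a, b), \<eta>). f (a, b, \<eta>)) x)) \<partial>jump_measure) =
      ennreal rate_const * ((\<integral>\<^sup>+\<omega>. ennreal (g (f (jump_pos \<omega>))) \<partial>collision_law) +
        (\<integral>\<^sup>+\<omega>. ennreal (g (f (jump_neg \<omega>))) \<partial>collision_law))"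
    if [measurable]: "g \<in> borel_measurable borel" for g :: "real \<Rightarrow> real"
    using nn_integral_jump_measure[of "\<lambda>x. ennreal (g (f x))"] by (simp add: case_prod_unfold)
  have fin: "(\<integral>\<^sup>+\<omega>. ennreal (f (jump_pos \<omega>)) \<partial>collision_law) < \<infinity>"
    "(\<integral>\<^sup>+\<omega>. ennreal (f (jump_neg \<omega>)) \<partial>collision_law) < \<infinity>"
    "(\<integral>\<^sup>+\<omega>. ennreal (- f (jump_pos \<omega>)) \<partial>collision_law) < \<infinity>"
    "(\<integral>\<^sup>+\<omega>. ennreal (- f (jump_neg \<omega>)) \<partial>collision_law) < \<infinity>"
    using p n by (auto simp: real_integrable_def less_top)
  show i: "integrable jump_measure (\<lambda>((a, b), \<eta>). f (a, b, \<eta>))"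
    unfolding real_integrable_def using fin m *[of "\<lambda>x. x"] *[of uminus]
    by (simp add: ennreal_mult_eq_top_iff less_top)
  show "(LINT ((a, b), \<eta>)|jump_measure. f (a, b, \<eta>)) =
      rate_const * ((LINT \<omega>|collision_law. f (jump_pos \<omega>)) + (LINT \<omega>|collision_law. f (jump_neg \<omega>)))"
    unfolding real_lebesgue_integral_def[OF i] real_lebesgue_integral_def[OF p]
      real_lebesgue_integral_def[OF n]
    using *[of "\<lambda>x. x"] *[of uminus] fin rate_const_pos
    by (auto simp: less_top_ennreal ennreal_mult[symmetric] ennreal_plus[symmetric] algebra_simps
        simp del: ennreal_plus)
qed

lemma measurable_rate_moment [measurable]:
  "(\<lambda>x. rate_moment k W (fst x) (snd x)) \<in> borel_measurable (borel \<Otimes>\<^sub>M borel)"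
  unfolding rate_moment_def set_lebesgue_integral_def by measurable

text \<open>Signed moments such as \<open>j_rate\<close> are Bochner integrals nested in an
  expectation. Integrability is first obtained on \<open>jump_measure\<close> from the hidden
  variables; Fubini then exhibits the inner integral.\<close>

lemma expectation_rate_moment:
  fixes g :: "real \<times> real \<Rightarrow> real"
  assumes [measurable]: "g \<in> borel_measurable (borel \<Otimes>\<^sub>M borel)"
    and p: "integrable collision_law (\<lambda>\<omega>. case jump_pos \<omega> of (a, b, \<eta>) \<Rightarrow> g (a, b) * \<eta> ^ k)"
    and n: "integrable collision_law (\<lambda>\<omega>. case jump_neg \<omega> of (a, b, \<eta>) \<Rightarrow> g (a, b) * \<eta> ^ k)"
  shows "integrable (energy_law \<Otimes>\<^sub>M energy_law) (\<lambda>x. g x * rate_moment k W (fst x) (snd x))"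
    and "(LINT x|(energy_law \<Otimes>\<^sub>M energy_law). g x * rate_moment k W (fst x) (snd x)) =
      rate_const * ((LINT \<omega>|collision_law. (case jump_pos \<omega> of (a, b, \<eta>) \<Rightarrow> g (a, b) * \<eta> ^ k)) +
        (LINT \<omega>|collision_law. (case jump_neg \<omega> of (a, b, \<eta>) \<Rightarrow> g (a, b) * \<eta> ^ k)))"
proof -
  let ?E = "energy_law \<Otimes>\<^sub>M energy_law"
  interpret E: prob_space energy_law by (rule prob_space_energy_law)
  interpret EE: pair_sigma_finite energy_law energy_law ..
  interpret EL: pair_sigma_finite ?E lborel
    by (simp add: pair_sigma_finite_def EE.sigma_finite_measure_axioms lborel.sigma_finite_measure_axioms)
  define f where "f = (\<lambda>(a, b, \<eta>). g (a, b) * \<eta> ^ k)"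
  \<comment> \<open>\<open>max 0\<close> matches the truncation by \<open>ennreal\<close> in
    \<open>jump_measure\<close>. Nonnegativity of the kernel is available only for positive
    energies, hence almost everywhere.\<close>
  define w where "w = (\<lambda>((a, b), \<eta>). max 0 (W a b \<eta> * indicator {- b<..<a} \<eta>))"
  have [measurable]: "f \<in> borel_measurable (borel \<Otimes>\<^sub>M borel \<Otimes>\<^sub>M borel)"
    "w \<in> borel_measurable (?E \<Otimes>\<^sub>M lborel)"
    unfolding f_def w_def case_prod_unfold by measurable
  have pn: "integrable collision_law (\<lambda>\<omega>. f (jump_pos \<omega>))"
    "integrable collision_law (\<lambda>\<omega>. f (jump_neg \<omega>))"
    using p n unfolding f_def .
  have jm: "jump_measure = density (?E \<Otimes>\<^sub>M lborel) (\<lambda>x. ennreal (w x))"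
    unfolding jump_measure_def w_def
    by (intro arg_cong2[where f = density] refl ext) (auto split: split_indicator)
  have m: "(\<lambda>((a, b), \<eta>). f (a, b, \<eta>)) \<in> borel_measurable (?E \<Otimes>\<^sub>M lborel)"
    unfolding case_prod_unfold by measurable
  have "integrable jump_measure (\<lambda>((a, b), \<eta>). f (a, b, \<eta>))"
    by (rule integral_jump_measure(1)[OF _ pn]) measurable
  then have i: "integrable (?E \<Otimes>\<^sub>M lborel) (\<lambda>x. w x * (case x of ((a, b), \<eta>) \<Rightarrow> f (a, b, \<eta>)))"
    unfolding jm by (subst (asm) integrable_density[OF m]) (auto simp: w_def case_prod_unfold)
  have eq: "(LINT ((a, b), \<eta>)|jump_measure. f (a, b, \<eta>)) =
      (LINT x|(?E \<Otimes>\<^sub>M lborel). w x * (case x of ((a, b), \<eta>) \<Rightarrow> f (a, b, \<eta>)))"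
    unfolding jm by (subst integral_density[OF m]) (auto simp: w_def case_prod_unfold)
  have pos1: "AE a in energy_law. 0 < a"
    unfolding energy_law_def by (rule AE_gamma_law_pos)
  have pos: "AE x in ?E. 0 < fst x \<and> 0 < snd x"
  proof (rule EE.AE_pair_measure)
    show "AE x in energy_law. AE y in energy_law. 0 < fst (x, y) \<and> 0 < snd (x, y)"
      using pos1 by eventually_elim (use pos1 in simp)
  qed measurable
  have ae: "AE x in ?E. (LINT \<eta>|lborel. w (x, \<eta>) * (case (x, \<eta>) of ((a, b), \<eta>) \<Rightarrow> f (a, b, \<eta>))) =
      g x * rate_moment k W (fst x) (snd x)"
    using pos
  proof eventually_elim
    case (elim x)
    have "(LINT \<eta>|lborel. w (x, \<eta>) * (case (x, \<eta>) of ((a, b), \<eta>) \<Rightarrow> f (a, b, \<eta>))) =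
        (LINT \<eta>|lborel. g x * (indicator {- snd x<..<fst x} \<eta> *\<^sub>R (\<eta> ^ k * W (fst x) (snd x) \<eta>)))"
      using elim kernel_nonneg[of "fst x" "snd x"]
      by (intro Bochner_Integration.integral_cong refl)
        (auto simp: w_def f_def case_prod_unfold max_def split: split_indicator)
    then show ?case by (simp add: rate_moment_def set_lebesgue_integral_def)
  qed
  show "integrable ?E (\<lambda>x. g x * rate_moment k W (fst x) (snd x))"
    using EL.integrable_fst'[OF i] by (subst integrable_cong_AE[OF _ _ ae, symmetric]) auto
  have "(LINT x|?E. g x * rate_moment k W (fst x) (snd x)) =
      (LINT x|(?E \<Otimes>\<^sub>M lborel). w x * (case x of ((a, b), \<eta>) \<Rightarrow> f (a, b, \<eta>)))"
    unfolding EL.integral_fst'[OF i, symmetric]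
    by (intro integral_cong_AE) (use ae in auto)
  also have "\<dots> = rate_const * ((LINT \<omega>|collision_law. f (jump_pos \<omega>)) + (LINT \<omega>|collision_law. f (jump_neg \<omega>)))"
    unfolding eq[symmetric] by (rule integral_jump_measure(2)[OF _ pn]) measurable
  finally show "(LINT x|?E. g x * rate_moment k W (fst x) (snd x)) =
      rate_const * ((LINT \<omega>|collision_law. (case jump_pos \<omega> of (a, b, \<eta>) \<Rightarrow> g (a, b) * \<eta> ^ k)) +
        (LINT \<omega>|collision_law. (case jump_neg \<omega> of (a, b, \<eta>) \<Rightarrow> g (a, b) * \<eta> ^ k)))"
    unfolding f_def .
qed

section \<open>Moments of the hidden variables\<close>

lemma all_moments_collision_law:
  "all_moments collision_law fst"
  "all_moments collision_law (\<lambda>\<omega>. fst (snd \<omega>))"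
  "all_moments collision_law (\<lambda>\<omega>. fst (snd (snd \<omega>)))"
  "all_moments collision_law (\<lambda>\<omega>. snd (snd (snd \<omega>)))"
  unfolding collision_law_def using beta_pos
  by (auto intro!: all_moments_fst all_moments_snd prob_space_pair prob_space_gamma_law
      all_moments_fst[where f = "\<lambda>x. x"] all_moments_snd[where f = "\<lambda>x. fst x"]
      all_moments_snd[where f = "\<lambda>x. fst (snd x)"] all_moments_snd[where f = "\<lambda>x. snd (snd x)"]
      all_moments_snd[where f = "\<lambda>x. snd x"] all_moments_snd[where f = "\<lambda>x. x"])

lemma prob_laws [simp]: "prob_space energy_law" "prob_space collision_law"
  by (rule prob_space_energy_law prob_space_collision_law)+

lemma all_moments_energy_law: "all_moments energy_law (\<lambda>x. x)"
  unfolding energy_law_def using beta_pos by simp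

lemma integral_energy_law_power:
  "integrable energy_law (\<lambda>x. x ^ n)" "(LINT x|energy_law. x ^ n) = pochhammer (\<beta> + 1/2) n"
  unfolding energy_law_def using beta_pos
  by (auto simp: integrable_gamma_law_power integral_gamma_law_power)

lemma integral_collision_law_monomial:
  "(LINT \<omega>|collision_law. fst \<omega> ^ i * (fst (snd \<omega>) ^ j *
      (fst (snd (snd \<omega>)) ^ k * snd (snd (snd \<omega>)) ^ l))) =
    pochhammer (1/2) i / 2 ^ i * (pochhammer \<beta> j * (pochhammer \<beta> k * fact l))"
proof -
  let ?z = "gamma_law (1/2) 2" and ?u = "gamma_law \<beta> 1" and ?s = "gamma_law 1 1"
  note P = prob_space_gamma_law[of "1/2" 2] prob_space_gamma_law[of \<beta> 1] prob_space_gamma_law[of 1 1]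
  note pow = integrable_gamma_law_power integral_gamma_law_power
  have s: "all_moments ?s (\<lambda>x. x ^ l)" using P by simp
  have vs: "all_moments (?u \<Otimes>\<^sub>M ?s) (\<lambda>x. fst x ^ k * snd x ^ l)"
    using P beta_pos by (intro all_moments_mult all_moments_fst[where f = "\<lambda>x. x ^ k"]
      all_moments_snd[where f = "\<lambda>x. x ^ l"]) auto
  have uvs: "all_moments (?u \<Otimes>\<^sub>M ?u \<Otimes>\<^sub>M ?s) (\<lambda>x. fst x ^ j * (fst (snd x) ^ k * snd (snd x) ^ l))"
    using P beta_pos vs by (intro all_moments_mult[OF all_moments_fst[where f = "\<lambda>x. x ^ j"]
      all_moments_snd[where f = "\<lambda>x. fst x ^ k * snd x ^ l"]]) (auto intro!: prob_space_pair)
  have "(LINT x|(?u \<Otimes>\<^sub>M ?s). fst x ^ k * snd x ^ l) = pochhammer \<beta> k * fact l"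
    using P beta_pos integral_pair_mult[of ?u ?s "\<lambda>x. x ^ k" "\<lambda>x. x ^ l"]
    by (simp add: pow pochhammer_fact)
  then have "(LINT x|(?u \<Otimes>\<^sub>M ?u \<Otimes>\<^sub>M ?s). fst x ^ j * (fst (snd x) ^ k * snd (snd x) ^ l)) =
      pochhammer \<beta> j * (pochhammer \<beta> k * fact l)"
    using P beta_pos vs integral_pair_mult[of ?u "?u \<Otimes>\<^sub>M ?s" "\<lambda>x. x ^ j" "\<lambda>x. fst x ^ k * snd x ^ l"]
    by (simp add: pow prob_space_pair all_moments_integrable)
  then show ?thesis
    unfolding collision_law_def
    using P beta_pos uvs integral_pair_mult[of ?z "?u \<Otimes>\<^sub>M ?u \<Otimes>\<^sub>M ?s" "\<lambda>x. x ^ i"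
        "\<lambda>x. fst x ^ j * (fst (snd x) ^ k * snd (snd x) ^ l)"]
    by (simp add: pow prob_space_pair all_moments_integrable)
qed

text \<open>In each static quantity the contributions of the two jump directions add up to a
  multiple of one power of \<open>s\<close>, and the unit exponential law has \<open>m\<close>-th
  moment \<open>fact m\<close>.\<close>

lemma expectation_rate_moment_sum:
  fixes g :: "real \<times> real \<Rightarrow> real"
  assumes g: "g \<in> borel_measurable (borel \<Otimes>\<^sub>M borel)"
    and p: "all_moments collision_law (\<lambda>\<omega>. case jump_pos \<omega> of (a, b, \<eta>) \<Rightarrow> g (a, b) * \<eta> ^ k)"
    and n: "all_moments collision_law (\<lambda>\<omega>. case jump_neg \<omega> of (a, b, \<eta>) \<Rightarrow> g (a, b) * \<eta> ^ k)"
    and sum: "\<And>z u v s. (case jump_pos (z, u, v, s) of (a, b, \<eta>) \<Rightarrow> g (a, b) * \<eta> ^ k) +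
      (case jump_neg (z, u, v, s) of (a, b, \<eta>) \<Rightarrow> g (a, b) * \<eta> ^ k) = r * s ^ m"
  shows "integrable (energy_law \<Otimes>\<^sub>M energy_law) (\<lambda>x. g x * rate_moment k W (fst x) (snd x))"
    and "(LINT x|(energy_law \<Otimes>\<^sub>M energy_law). g x * rate_moment k W (fst x) (snd x)) =
      rate_const * r * fact m"
proof -
  note pn = p[THEN all_moments_integrable] n[THEN all_moments_integrable]
  show "integrable (energy_law \<Otimes>\<^sub>M energy_law) (\<lambda>x. g x * rate_moment k W (fst x) (snd x))"
    by (rule expectation_rate_moment(1)[OF g pn])
  have "(LINT x|(energy_law \<Otimes>\<^sub>M energy_law). g x * rate_moment k W (fst x) (snd x)) =
      rate_const * (LINT \<omega>|collision_law. (case jump_pos \<omega> of (a, b, \<eta>) \<Rightarrow> g (a, b) * \<eta> ^ k) +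
        (case jump_neg \<omega> of (a, b, \<eta>) \<Rightarrow> g (a, b) * \<eta> ^ k))"
    unfolding expectation_rate_moment(2)[OF g pn] by (subst Bochner_Integration.integral_add[OF pn]) simp
  also have "\<dots> = rate_const * (LINT \<omega>|collision_law. r * snd (snd (snd \<omega>)) ^ m)"
  proof -
    have "(case jump_pos \<omega> of (a, b, \<eta>) \<Rightarrow> g (a, b) * \<eta> ^ k) +
        (case jump_neg \<omega> of (a, b, \<eta>) \<Rightarrow> g (a, b) * \<eta> ^ k) = r * snd (snd (snd \<omega>)) ^ m" for \<omega>
      using sum[of "fst \<omega>" "fst (snd \<omega>)" "fst (snd (snd \<omega>))" "snd (snd (snd \<omega>))"]
      by (simp only: prod.collapse)
    then show ?thesis by presburger
  qed
  also have "\<dots> = rate_const * r * fact m"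
    using integral_collision_law_monomial[of 0 0 0 m] by simp
  finally show "(LINT x|(energy_law \<Otimes>\<^sub>M energy_law). g x * rate_moment k W (fst x) (snd x)) =
      rate_const * r * fact m" .
qed

section \<open>Values of the four static conductivities\<close>

lemma integral_equilibrium_two:
  fixes f :: "real \<times> real \<Rightarrow> real"
  assumes "i \<noteq> j" and f: "f \<in> borel_measurable (borel \<Otimes>\<^sub>M borel)"
  shows "(LINT \<epsilon>|equilibrium d 1. f (\<epsilon> i, \<epsilon> j)) = (LINT x|(energy_law \<Otimes>\<^sub>M energy_law). f x)"
proof -
  have [measurable]: "f \<in> borel_measurable (energy_law \<Otimes>\<^sub>M energy_law)"
    using f by measurable
  have "(LINT x|(energy_law \<Otimes>\<^sub>M energy_law). f x) =
      (LINT x|distr (PiM UNIV (\<lambda>_. energy_law)) (energy_law \<Otimes>\<^sub>M energy_law) (\<lambda>\<epsilon>. (\<epsilon> i, \<epsilon> j)). f x)"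
    by (simp only: distr_PiM_two[OF prob_laws(1) assms(1)])
  then show ?thesis
    unfolding equilibrium_eq by (subst (asm) integral_distr) auto
qed

lemma kappa1_eq:
  assumes "i \<noteq> j"
  shows "kappa1 W d i j = 2 * rate_const"
proof -
  have "(LINT \<epsilon>|equilibrium d 1. (\<epsilon> i - \<epsilon> j) * rate_moment 1 W (\<epsilon> i) (\<epsilon> j)) =
      (LINT x|(energy_law \<Otimes>\<^sub>M energy_law). (fst x - snd x) * rate_moment 1 W (fst x) (snd x))"
    using integral_equilibrium_two[OF assms, of "\<lambda>x. (fst x - snd x) * rate_moment 1 W (fst x) (snd x)"]
    by simp
  \<comment> \<open>\<open>(u - v + s) * s + (u - v - s) * (- s) = 2 * s^2\<close>.\<close>
  also have "\<dots> = rate_const * 2 * fact 2"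
    using all_moments_collision_law
    by (intro expectation_rate_moment_sum(2)) (auto simp: jump_pos_def jump_neg_def case_prod_unfold
        power2_eq_square algebra_simps)
  finally show ?thesis by (simp add: kappa1_def)
qed

lemma kappa2_eq:
  assumes "i \<noteq> j"
  shows "kappa2 W d i j = 2 * rate_const"
proof -
  have "(LINT \<epsilon>|equilibrium d 1. rate_moment 2 W (\<epsilon> i) (\<epsilon> j)) =
      (LINT x|(energy_law \<Otimes>\<^sub>M energy_law). 1 * rate_moment 2 W (fst x) (snd x))"
    using integral_equilibrium_two[OF assms, of "\<lambda>x. rate_moment 2 W (fst x) (snd x)"] by simp
  also have "\<dots> = rate_const * 2 * fact 2"
    using all_moments_collision_law
    by (intro expectation_rate_moment_sum(2)) (auto simp: jump_pos_def jump_neg_def case_prod_unfold)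
  finally show ?thesis by (simp add: kappa2_def)
qed

lemma kappa_f_eq:
  assumes "i \<noteq> j"
  shows "kappa_f W d i j = 2 * rate_const"
proof -
  have "(LINT \<epsilon>|equilibrium d 1. rate_moment 0 W (\<epsilon> i) (\<epsilon> j)) =
      (LINT x|(energy_law \<Otimes>\<^sub>M energy_law). 1 * rate_moment 0 W (fst x) (snd x))"
    using integral_equilibrium_two[OF assms, of "\<lambda>x. rate_moment 0 W (fst x) (snd x)"] by simp
  also have "\<dots> = rate_const * 2 * fact 0"
    by (intro expectation_rate_moment_sum(2)) (auto simp: jump_pos_def jump_neg_def case_prod_unfold)
  finally show ?thesis by (simp add: kappa_f_def)
qed

text \<open>Only site 1 contributes: site 0 carries the factor \<open>i = 0\<close>, and a site off
  the bond is independent of the current, whose mean vanishes because the two jump directions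
  cancel.\<close>

lemma kappa_s_eq: "kappa_s W d = 2 * rate_const"
proof -
  let ?E = "energy_law \<Otimes>\<^sub>M energy_law"
  let ?J = "\<lambda>x. rate_moment 1 W (fst x) (snd x)"
  let ?term = "\<lambda>i::int. of_int i * (LINT \<epsilon>|equilibrium d 1. \<epsilon> i * ?J (\<epsilon> 0, \<epsilon> 1))"
  have "integrable ?E (\<lambda>x. 1 * ?J x)" "(LINT x|?E. 1 * ?J x) = rate_const * 0 * fact 0"
    using all_moments_collision_law
    by (intro expectation_rate_moment_sum; auto simp: jump_pos_def jump_neg_def case_prod_unfold)+
  then have J: "integrable ?E ?J" "(LINT x|?E. ?J x) = 0" by auto
  \<comment> \<open>\<open>(v + z) * s - (v + z + s) * s = - s^2\<close>.\<close>
  have "(LINT x|?E. snd x * ?J x) = rate_const * (-1) * fact 2"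
    using all_moments_collision_law
    by (intro expectation_rate_moment_sum(2)) (auto simp: jump_pos_def jump_neg_def case_prod_unfold
        power2_eq_square algebra_simps)
  then have one: "?term 1 = - 2 * rate_const"
    using integral_equilibrium_two[of 0 1 "\<lambda>x. snd x * ?J x"] by simp
  have zero: "?term i = 0" if "i \<noteq> 1" for i
  proof (cases "i = 0")
    case False
    have m: "(\<lambda>x. fst x * ?J (snd x)) \<in> borel_measurable (energy_law \<Otimes>\<^sub>M energy_law \<Otimes>\<^sub>M energy_law)"
      by measurable
    have "(LINT \<epsilon>|equilibrium d 1. \<epsilon> i * ?J (\<epsilon> 0, \<epsilon> 1)) =
        (LINT x|distr (equilibrium d 1) (energy_law \<Otimes>\<^sub>M ?E) (\<lambda>\<epsilon>. (\<epsilon> i, \<epsilon> 0, \<epsilon> 1)). fst x * ?J (snd x))"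
      unfolding equilibrium_eq by (subst integral_distr[OF _ m]) auto
    also have "\<dots> = (LINT x|(energy_law \<Otimes>\<^sub>M ?E). fst x * ?J (snd x))"
      unfolding equilibrium_eq using that False by (subst distr_PiM_three) auto
    also have "\<dots> = (LINT x|energy_law. x) * (LINT x|?E. ?J x)"
      by (rule integral_pair_mult)
        (use J all_moments_energy_law in \<open>auto intro!: prob_space_pair all_moments_integrable\<close>)
    finally show ?thesis using J by simp
  qed simp
  have "(\<Sum>\<^sub>\<infinity>i\<in>UNIV. ?term i) = (\<Sum>\<^sub>\<infinity>i\<in>{1}. ?term i)"
    using zero by (intro infsum_cong_neutral) auto
  then show ?thesis using one by (simp add: kappa_s_def)
qed

subsection \<open>The Dirichlet form of a trial function\<close>

text \<open>The neighbouring sites -1 and 2 keep independent equilibrium energies \<open>p\<close>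
  and \<open>q\<close>; the two energies of the bond and the jump are replaced by the hidden
  variables.\<close>

definition site_law :: "(real \<times> real \<times> real \<times> real \<times> real \<times> real) measure" where
  "site_law = energy_law \<Otimes>\<^sub>M energy_law \<Otimes>\<^sub>M collision_law"

definition site_monomial ::
    "nat \<Rightarrow> nat \<Rightarrow> nat \<Rightarrow> nat \<Rightarrow> nat \<Rightarrow> nat \<Rightarrow> real \<times> real \<times> real \<times> real \<times> real \<times> real \<Rightarrow> real" where
  "site_monomial h e i j k l = (\<lambda>(p, q, z, u, v, s). p ^ h * (q ^ e * (z ^ i * (u ^ j * (v ^ k * s ^ l)))))"

lemma prob_space_site_law [simp]: "prob_space site_law"
  unfolding site_law_def by (intro prob_space_pair prob_laws)

lemma all_moments_site_law:
  "all_moments site_law fst"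
  "all_moments site_law (\<lambda>x. fst (snd x))"
  "all_moments collision_law f \<Longrightarrow> all_moments site_law (\<lambda>x. f (snd (snd x)))"
  unfolding site_law_def using all_moments_energy_law
  by (auto intro!: prob_space_pair all_moments_fst[where f = "\<lambda>x. x"]
      all_moments_snd[where f = "\<lambda>x. fst x"] all_moments_snd[where f = "\<lambda>x. f (snd x)"]
      all_moments_snd[where f = f])

lemmas all_moments_sites = all_moments_site_law(1,2)
  all_moments_collision_law[THEN all_moments_site_law(3)]

lemma integrable_site_monomial [simp]: "integrable site_law (site_monomial h e i j k l)"
  unfolding site_monomial_def case_prod_unfold
  by (intro all_moments_integrable all_moments_mult all_moments_power all_moments_sites) auto

lemma integral_site_monomial:
  "integral\<^sup>L site_law (site_monomial h e i j k l) =
    pochhammer (\<beta> + 1/2) h * (pochhammer (\<beta> + 1/2) e *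
      (pochhammer (1/2) i / 2 ^ i * (pochhammer \<beta> j * (pochhammer \<beta> k * fact l))))"
proof -
  let ?m = "\<lambda>\<omega>. fst \<omega> ^ i * (fst (snd \<omega>) ^ j * (fst (snd (snd \<omega>)) ^ k * snd (snd (snd \<omega>)) ^ l))"
  have m: "all_moments collision_law ?m"
    by (intro all_moments_mult all_moments_power all_moments_collision_law) auto
  have qm: "all_moments (energy_law \<Otimes>\<^sub>M collision_law) (\<lambda>x. fst x ^ e * ?m (snd x))"
    using all_moments_energy_law
    by (intro all_moments_mult[OF all_moments_fst[where f = "\<lambda>x. x ^ e"]
        all_moments_snd[OF prob_laws m]]) auto
  have "(LINT x|(energy_law \<Otimes>\<^sub>M collision_law). fst x ^ e * ?m (snd x)) =
      pochhammer (\<beta> + 1/2) e * (LINT \<omega>|collision_law. ?m \<omega>)"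
    using integral_pair_mult[OF prob_laws, of "\<lambda>x. x ^ e" ?m] m
    by (simp add: integral_energy_law_power all_moments_integrable)
  moreover have "(LINT x|site_law. fst x ^ h * (fst (snd x) ^ e * ?m (snd (snd x)))) =
      pochhammer (\<beta> + 1/2) h * (LINT x|(energy_law \<Otimes>\<^sub>M collision_law). fst x ^ e * ?m (snd x))"
    unfolding site_law_def
    using integral_pair_mult[OF prob_laws(1) prob_space_pair[OF prob_laws], of "\<lambda>x. x ^ h"
        "\<lambda>x. fst x ^ e * ?m (snd x)"] qm
    by (simp add: integral_energy_law_power all_moments_integrable)
  ultimately show ?thesis
    unfolding site_monomial_def case_prod_unfold integral_collision_law_monomial by simp
qed

text \<open>
  The gradient of \<open>\<epsilon>\<^sub>0\<^sup>2 \<epsilon>\<^sub>1\<close>, where \<open>p\<close> and \<open>q\<close> are the energies at the sites \<open>-1\<close> and \<open>2\<close>.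
\<close>

definition site_grad :: "real \<Rightarrow> real \<Rightarrow> real \<Rightarrow> real \<Rightarrow> real \<Rightarrow> real" where
  "site_grad p q a b \<eta> =
     - (p\<^sup>2 * \<eta>) + ((a - \<eta>)\<^sup>2 * (b + \<eta>) - a\<^sup>2 * b) + ((b + \<eta>)\<^sup>2 - b\<^sup>2) * q"

definition grad_pos :: "real \<times> real \<times> real \<times> real \<times> real \<times> real \<Rightarrow> real" where
  "grad_pos = (\<lambda>(p, q, \<omega>). case jump_pos \<omega> of (a, b, \<eta>) \<Rightarrow> site_grad p q a b \<eta>)"

definition grad_neg :: "real \<times> real \<times> real \<times> real \<times> real \<times> real \<Rightarrow> real" where
  "grad_neg = (\<lambda>(p, q, \<omega>). case jump_neg \<omega> of (a, b, \<eta>) \<Rightarrow> site_grad p q a b \<eta>)"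

abbreviation site_jump :: "real \<times> real \<times> real \<times> real \<times> real \<times> real \<Rightarrow> real" where
  "site_jump x \<equiv> snd (snd (snd (snd (snd x))))"

lemma all_moments_grad: "all_moments site_law grad_pos" "all_moments site_law grad_neg"
  unfolding grad_pos_def grad_neg_def site_grad_def jump_pos_def jump_neg_def case_prod_unfold
  by (auto intro!: all_moments_sites all_moments_add all_moments_diff all_moments_mult
      all_moments_uminus all_moments_power simp del: prob_space_site_law simp: prob_space_site_law)

text \<open>The moments make this a polynomial of degree at most two in \<beta>. Its quadratic and
  linear coefficients cancel, so the same trial function, with the same slope, serves both
  kernels.\<close>

lemma integral_cross_term:
  "(LINT x|site_law. site_jump x * grad_pos x - site_jump x * grad_neg x) = 1/4"
proof -
  let ?m = site_monomial
  have "(\<lambda>x. site_jump x * grad_pos x - site_jump x * grad_neg x) =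
      (\<lambda>x. - 2 * ?m 2 0 0 0 0 2 x - 2 * ?m 0 0 2 0 0 2 x + 2 * ?m 0 0 0 2 0 2 x
        - 4 * ?m 0 0 1 0 1 2 x - 4 * ?m 0 0 0 1 1 2 x - 2 * ?m 0 0 1 0 0 3 x - 2 * ?m 0 0 0 0 1 3 x
        + 4 * ?m 0 1 1 0 0 2 x + 4 * ?m 0 1 0 0 1 2 x + 2 * ?m 0 1 0 0 0 3 x)"
    unfolding grad_pos_def grad_neg_def site_grad_def jump_pos_def jump_neg_def site_monomial_def
      case_prod_unfold
    by (rule ext) (simp add: power2_eq_square power3_eq_cube algebra_simps)
  then have "(LINT x|site_law. site_jump x * grad_pos x - site_jump x * grad_neg x) =
      - 2 * integral\<^sup>L site_law (?m 2 0 0 0 0 2) - 2 * integral\<^sup>L site_law (?m 0 0 2 0 0 2)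
      + 2 * integral\<^sup>L site_law (?m 0 0 0 2 0 2) - 4 * integral\<^sup>L site_law (?m 0 0 1 0 1 2)
      - 4 * integral\<^sup>L site_law (?m 0 0 0 1 1 2) - 2 * integral\<^sup>L site_law (?m 0 0 1 0 0 3)
      - 2 * integral\<^sup>L site_law (?m 0 0 0 0 1 3) + 4 * integral\<^sup>L site_law (?m 0 1 1 0 0 2)
      + 4 * integral\<^sup>L site_law (?m 0 1 0 0 1 2) + 2 * integral\<^sup>L site_law (?m 0 1 0 0 0 3)"
    by simp
  also have "\<dots> = 1/4"
    unfolding integral_site_monomial
    by (simp add: numeral_2_eq_2 numeral_3_eq_3 pochhammer_Suc field_simps)
  finally show ?thesis .
qed

section \<open>The Dirichlet form at the trial function\<close>

definition trial_function :: "real \<Rightarrow> (int \<Rightarrow> real) \<Rightarrow> real" where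
  "trial_function t \<epsilon> = t * ((\<epsilon> 0)\<^sup>2 * \<epsilon> 1)"

lemma trial_function_cylinder: "trial_function t \<in> cylinder_functions d"
proof -
  have [measurable]: "(\<lambda>\<epsilon>. \<epsilon> i) \<in> measurable (PiM UNIV (\<lambda>_. energy_law)) borel" for i :: int
    using measurable_component_singleton[of i UNIV "\<lambda>_. energy_law"] by simp
  have fg: "all_moments (energy_law \<Otimes>\<^sub>M energy_law) fst" "all_moments (energy_law \<Otimes>\<^sub>M energy_law) snd"
    using all_moments_energy_law
    by (auto intro!: all_moments_fst[where f = "\<lambda>x. x"] all_moments_snd[where f = "\<lambda>x. x"])
  have "all_moments (energy_law \<Otimes>\<^sub>M energy_law) (\<lambda>x. (t * ((fst x)\<^sup>2 * snd x))\<^sup>2)"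
    by (intro all_moments_power all_moments_mult all_moments_const fg prob_space_pair prob_laws)
  then have "all_moments (equilibrium d 1) (\<lambda>\<epsilon>. (t * ((fst (\<epsilon> 0, \<epsilon> 1))\<^sup>2 * snd (\<epsilon> 0, \<epsilon> 1)))\<^sup>2)"
    unfolding equilibrium_eq
    by (rule all_moments_distr[where X = "\<lambda>\<epsilon>. (\<epsilon> 0, \<epsilon> 1)"]) (auto simp: distr_PiM_two)
  moreover have "trial_function t \<in> borel_measurable (equilibrium d 1)"
    unfolding equilibrium_eq trial_function_def by measurable
  moreover have "\<exists>A::int set. finite A \<and>
      (\<forall>\<epsilon> \<epsilon>'. (\<forall>i\<in>A. \<epsilon> i = \<epsilon>' i) \<longrightarrow> trial_function t \<epsilon> = trial_function t \<epsilon>')"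
    by (rule exI[of _ "{0, 1}"]) (auto simp: trial_function_def)
  ultimately show ?thesis
    using all_moments_integrable by (auto simp: cylinder_functions_def trial_function_def)
qed

lemma grad01_trial_function:
  "grad01 \<eta> (trial_function t) \<epsilon> = t * site_grad (\<epsilon> (-1)) (\<epsilon> 2) (\<epsilon> 0) (\<epsilon> 1) \<eta>"
proof -
  let ?\<epsilon>' = "\<epsilon>(0 := \<epsilon> 0 - \<eta>, 1 := \<epsilon> 1 + \<eta>)"
  let ?D = "\<lambda>i. lattice_shift i (trial_function t) ?\<epsilon>' - lattice_shift i (trial_function t) \<epsilon>"
  \<comment> \<open>The shift by \<open>i\<close> reads the sites \<open>i\<close> and
    \<open>i + 1\<close>, and only the energies at 0 and 1 change.\<close>
  have zero: "?D i = 0" if "i \<notin> {-1, 0, 1}" for i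
    using that by (simp add: lattice_shift_def trial_function_def)
  have "grad01 \<eta> (trial_function t) \<epsilon> = (\<Sum>\<^sub>\<infinity>i\<in>{-1, 0, 1}. ?D i)"
    unfolding grad01_def using zero by (intro infsum_cong_neutral) auto
  also have "\<dots> = t * site_grad (\<epsilon> (-1)) (\<epsilon> 2) (\<epsilon> 0) (\<epsilon> 1) \<eta>"
    by (simp add: lattice_shift_def trial_function_def site_grad_def algebra_simps)
  finally show ?thesis .
qed

text \<open>The squares for \<open>\<eta> = s\<close> and \<open>\<eta> = - s\<close>, added, so
  that a single integral over the hidden variables gives the form.\<close>

definition dirichlet_integrand ::
    "real \<Rightarrow> real \<times> real \<times> real \<times> real \<times> real \<times> real \<Rightarrow> real" where
  "dirichlet_integrand t x = (site_jump x + t * grad_pos x)\<^sup>2 + (- site_jump x + t * grad_neg x)\<^sup>2"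

lemma dirichlet_integrand_nonneg: "0 \<le> dirichlet_integrand t x"
  by (simp add: dirichlet_integrand_def)

lemma all_moments_dirichlet_integrand: "all_moments site_law (dirichlet_integrand t)"
  unfolding dirichlet_integrand_def
  by (auto intro!: all_moments_sites all_moments_grad all_moments_add all_moments_power
      all_moments_mult all_moments_diff)

text \<open>For fixed neighbouring energies the bond is handled by \<open>nn_integral_jumps\<close>.
  The integrals stay nonnegative until the end, so finiteness of the form is a result, drawn from
  the moments of the hidden variables.\<close>

lemma dirichlet_form_trial_function:
  "(\<integral>\<^sup>+\<epsilon>. (\<integral>\<^sup>+\<eta>\<in>{- \<epsilon> 1<..<\<epsilon> 0}. ennreal (W (\<epsilon> 0) (\<epsilon> 1) \<eta> *
      (\<eta> + grad01 \<eta> (trial_function t) \<epsilon>)\<^sup>2) \<partial>lborel) \<partial>equilibrium d 1) =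
    ennreal (rate_const * (LINT x|site_law. dirichlet_integrand t x))"
proof -
  let ?E = energy_law
  define G where "G = (\<lambda>p q (a, b, \<eta>). ennreal ((\<eta> + t * site_grad p q a b \<eta>)\<^sup>2))"
  define H where "H = (\<lambda>(p, q, a, b). \<integral>\<^sup>+\<eta>. (ennreal (W a b \<eta>) * indicator {- b<..<a} \<eta>) *
      G p q (a, b, \<eta>) \<partial>lborel)"
  have H_meas: "H \<in> borel_measurable (?E \<Otimes>\<^sub>M ?E \<Otimes>\<^sub>M ?E \<Otimes>\<^sub>M ?E)"
    unfolding H_def G_def site_grad_def case_prod_unfold by measurable
  have G_meas: "G p q \<in> borel_measurable (borel \<Otimes>\<^sub>M borel \<Otimes>\<^sub>M borel)" for p q
    unfolding G_def site_grad_def case_prod_unfold by measurable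
  have sf: "sigma_finite_measure ?E" "sigma_finite_measure (?E \<Otimes>\<^sub>M ?E)"
    "sigma_finite_measure (?E \<Otimes>\<^sub>M ?E \<Otimes>\<^sub>M ?E)" "sigma_finite_measure collision_law"
    "sigma_finite_measure (?E \<Otimes>\<^sub>M collision_law)"
    by (intro prob_space_imp_sigma_finite prob_space_pair prob_laws)+
  have dens: "(\<lambda>x. ennreal (dirichlet_integrand t x)) \<in> borel_measurable site_law"
    using all_moments_dirichlet_integrand[THEN all_moments_measurable] by measurable
  have "(\<integral>\<^sup>+\<epsilon>. (\<integral>\<^sup>+\<eta>\<in>{- \<epsilon> 1<..<\<epsilon> 0}. ennreal (W (\<epsilon> 0) (\<epsilon> 1) \<eta> *
      (\<eta> + grad01 \<eta> (trial_function t) \<epsilon>)\<^sup>2) \<partial>lborel) \<partial>equilibrium d 1) =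
      (\<integral>\<^sup>+\<epsilon>. H (\<epsilon> (-1), \<epsilon> 2, \<epsilon> 0, \<epsilon> 1) \<partial>PiM (UNIV :: int set) (\<lambda>_. ?E))"
    unfolding equilibrium_eq H_def G_def grad01_trial_function
    by (intro nn_integral_cong) (simp add: ennreal_mult'' mult_ac)
  also have "\<dots> = integral\<^sup>N (distr (PiM (UNIV :: int set) (\<lambda>_. ?E)) (?E \<Otimes>\<^sub>M ?E \<Otimes>\<^sub>M ?E \<Otimes>\<^sub>M ?E)
      (\<lambda>\<epsilon>. (\<epsilon> (-1), \<epsilon> 2, \<epsilon> 0, \<epsilon> 1))) H"
    by (subst nn_integral_distr) (use H_meas in auto)
  also have "\<dots> = integral\<^sup>N (?E \<Otimes>\<^sub>M ?E \<Otimes>\<^sub>M ?E \<Otimes>\<^sub>M ?E) H"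
    by (subst distr_PiM_four) auto
  also have "\<dots> = (\<integral>\<^sup>+p. \<integral>\<^sup>+x. H (p, x) \<partial>(?E \<Otimes>\<^sub>M ?E \<Otimes>\<^sub>M ?E) \<partial>?E)"
    by (rule nn_integral_pair_measure[OF sf(3) H_meas])
  also have "\<dots> = (\<integral>\<^sup>+p. \<integral>\<^sup>+q. \<integral>\<^sup>+x. H (p, q, x) \<partial>(?E \<Otimes>\<^sub>M ?E) \<partial>?E \<partial>?E)"
    by (intro nn_integral_cong nn_integral_pair_measure[OF sf(2)] measurable_compose[OF _ H_meas]) auto
  also have "\<dots> = (\<integral>\<^sup>+p. \<integral>\<^sup>+q. \<integral>\<^sup>+a. \<integral>\<^sup>+b. H (p, q, a, b) \<partial>?E \<partial>?E \<partial>?E \<partial>?E)"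
    by (intro nn_integral_cong nn_integral_pair_measure[OF sf(1)] measurable_compose[OF _ H_meas]) auto
  also have "\<dots> = (\<integral>\<^sup>+p. \<integral>\<^sup>+q. ennreal rate_const * ((\<integral>\<^sup>+\<omega>. G p q (jump_pos \<omega>) \<partial>collision_law) +
      (\<integral>\<^sup>+\<omega>. G p q (jump_neg \<omega>) \<partial>collision_law)) \<partial>?E \<partial>?E)"
    unfolding H_def prod.case nn_integral_jumps[OF G_meas] ..
  also have "\<dots> = (\<integral>\<^sup>+p. \<integral>\<^sup>+q. \<integral>\<^sup>+\<omega>. ennreal rate_const * ennreal (dirichlet_integrand t (p, q, \<omega>))
      \<partial>collision_law \<partial>?E \<partial>?E)"
  proof (intro nn_integral_cong)
    fix p q
    have m: "(\<lambda>\<omega>. G p q (jump_pos \<omega>)) \<in> borel_measurable collision_law"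
      "(\<lambda>\<omega>. G p q (jump_neg \<omega>)) \<in> borel_measurable collision_law"
      by (rule measurable_compose[OF measurable_jumps(1) G_meas]
          measurable_compose[OF measurable_jumps(2) G_meas])+
    have eq: "G p q (jump_pos \<omega>) + G p q (jump_neg \<omega>) = ennreal (dirichlet_integrand t (p, q, \<omega>))" for \<omega>
      unfolding G_def dirichlet_integrand_def grad_pos_def grad_neg_def
      by (simp add: jump_pos_def jump_neg_def case_prod_unfold ennreal_plus[symmetric] del: ennreal_plus)
    have m_sum: "(\<lambda>\<omega>. ennreal (dirichlet_integrand t (p, q, \<omega>))) \<in> borel_measurable collision_law"
      unfolding eq[symmetric] using m by measurable
    show "ennreal rate_const * ((\<integral>\<^sup>+\<omega>. G p q (jump_pos \<omega>) \<partial>collision_law) +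
        (\<integral>\<^sup>+\<omega>. G p q (jump_neg \<omega>) \<partial>collision_law)) =
        (\<integral>\<^sup>+\<omega>. ennreal rate_const * ennreal (dirichlet_integrand t (p, q, \<omega>)) \<partial>collision_law)"
      using m m_sum by (simp add: nn_integral_add[symmetric] nn_integral_cmult eq)
  qed
  also have "\<dots> = (\<integral>\<^sup>+p. \<integral>\<^sup>+x. ennreal rate_const * ennreal (dirichlet_integrand t (p, x))
      \<partial>(?E \<Otimes>\<^sub>M collision_law) \<partial>?E)"
    using dens unfolding site_law_def
    by (intro nn_integral_cong nn_integral_pair_measure[OF sf(4), symmetric] borel_measurable_times_ennreal
        measurable_compose[OF _ dens[unfolded site_law_def]]) auto
  also have "\<dots> = (\<integral>\<^sup>+x. ennreal rate_const * ennreal (dirichlet_integrand t x) \<partial>site_law)"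
    using dens unfolding site_law_def
    by (intro nn_integral_pair_measure[OF sf(5), symmetric]) auto
  also have "\<dots> = ennreal rate_const * ennreal (LINT x|site_law. dirichlet_integrand t x)"
    using dens dirichlet_integrand_nonneg all_moments_dirichlet_integrand[THEN all_moments_integrable]
    by (simp add: nn_integral_cmult nn_integral_eq_integral)
  also have "\<dots> = ennreal (rate_const * (LINT x|site_law. dirichlet_integrand t x))"
    using rate_const_pos by (simp add: ennreal_mult')
  finally show ?thesis .
qed

text \<open>The infimum is at most its value at the trial function. That value is a finite real, so
  the bound passes through \<open>enn2real\<close>.\<close>

lemma kappa_le_dirichlet:
  "kappa W d \<le> 1/2 * (rate_const * (LINT x|site_law. dirichlet_integrand t x))"
proof -
  let ?I = "rate_const * (LINT x|site_law. dirichlet_integrand t x)"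
  have nn: "0 \<le> ?I"
    using rate_const_pos dirichlet_integrand_nonneg by (simp add: integral_nonneg_AE)
  have "(INF f\<in>cylinder_functions d. \<integral>\<^sup>+\<epsilon>. (\<integral>\<^sup>+\<eta>\<in>{- \<epsilon> 1<..<\<epsilon> 0}. ennreal (W (\<epsilon> 0) (\<epsilon> 1) \<eta> *
      (\<eta> + grad01 \<eta> f \<epsilon>)\<^sup>2) \<partial>lborel) \<partial>equilibrium d 1) \<le> ennreal ?I"
    unfolding dirichlet_form_trial_function[symmetric] by (rule INF_lower[OF trial_function_cylinder])
  then have "enn2real (INF f\<in>cylinder_functions d. \<integral>\<^sup>+\<epsilon>. (\<integral>\<^sup>+\<eta>\<in>{- \<epsilon> 1<..<\<epsilon> 0}. ennreal (W (\<epsilon> 0) (\<epsilon> 1) \<eta> *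
      (\<eta> + grad01 \<eta> f \<epsilon>)\<^sup>2) \<partial>lborel) \<partial>equilibrium d 1) \<le> ?I"
    using nn by (intro enn2real_leI) auto
  then show ?thesis by (simp add: kappa_def)
qed

text \<open>Up to the factor \<open>rate_const\<close> the form is
  \<open>4 + t / 2 + t^2 * y\<close>; the nonzero slope at \<open>t = 0\<close> pushes it below 4
  for small negative \<open>t\<close>.\<close>

lemma kappa_less: "kappa W d < 2 * rate_const"
proof -
  let ?X = "\<lambda>x. site_jump x * grad_pos x - site_jump x * grad_neg x"
  let ?Y = "\<lambda>x. (grad_pos x)\<^sup>2 + (grad_neg x)\<^sup>2"
  define y where "y = (LINT x|site_law. ?Y x)"
  have y: "0 \<le> y" unfolding y_def by (intro integral_nonneg_AE) auto
  \<comment> \<open>The minimizer of \<open>t / 2 + t^2 * (y + 1)\<close>, with minimum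
    \<open>t / 4\<close>. Using \<open>y + 1\<close> in place of \<open>y\<close> avoids a zero
    denominator.\<close>
  define t where "t = - 1 / (4 * (y + 1))"
  have int: "integrable site_law (\<lambda>x. (site_jump x)\<^sup>2)" "integrable site_law ?X" "integrable site_law ?Y"
    by (auto intro!: all_moments_integrable[OF all_moments_add] all_moments_integrable[OF all_moments_power]
        all_moments_integrable[OF all_moments_diff] all_moments_mult all_moments_power
        all_moments_sites all_moments_grad)
  have "(LINT x|site_law. (site_jump x)\<^sup>2) = integral\<^sup>L site_law (site_monomial 0 0 0 0 0 2)"
    by (simp add: site_monomial_def case_prod_unfold)
  then have s: "(LINT x|site_law. (site_jump x)\<^sup>2) = 2"
    by (simp add: integral_site_monomial)
  have "(LINT x|site_law. dirichlet_integrand t x) =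
      (LINT x|site_law. 2 * (site_jump x)\<^sup>2 + 2 * t * ?X x + t\<^sup>2 * ?Y x)"
    by (intro Bochner_Integration.integral_cong refl)
      (simp add: dirichlet_integrand_def power2_eq_square algebra_simps)
  also have "\<dots> = 2 * (LINT x|site_law. (site_jump x)\<^sup>2) + 2 * t * (LINT x|site_law. ?X x)
      + t\<^sup>2 * (LINT x|site_law. ?Y x)"
    using int by (simp del: Bochner_Integration.integral_diff)
  also have "\<dots> = 4 + 2 * t * (1/4) + t\<^sup>2 * y"
    unfolding s integral_cross_term y_def by simp
  also have "\<dots> < 4"
  proof -
    have "t\<^sup>2 * y \<le> t\<^sup>2 * (y + 1)" by (intro mult_left_mono) auto
    also have "t\<^sup>2 * (y + 1) = - t / 4"
    proof -
      have "(- 1 / (4 * w))\<^sup>2 * w = - (- 1 / (4 * w)) / 4" if "0 < w" for w :: real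
        using that by (simp add: power2_eq_square)
      from this[of "y + 1"] show ?thesis using y unfolding t_def by simp
    qed
    finally have "4 + 2 * t * (1/4) + t\<^sup>2 * y \<le> 4 + t / 4" by simp
    moreover have "t < 0" using y unfolding t_def by simp
    ultimately show ?thesis by simp
  qed
  finally have "rate_const * (LINT x|site_law. dirichlet_integrand t x) < rate_const * 4"
    using rate_const_pos by simp
  then show ?thesis using kappa_le_dirichlet[of t] by simp
qed

theorem conductivities:
  assumes "a \<noteq> b"
  shows "kappa W d < kappa_s W d \<and> kappa_s W d = kappa1 W d a b \<and>
    kappa1 W d a b = kappa2 W d a b \<and> kappa2 W d a b = kappa_f W d a b"
  using kappa_less kappa1_eq[OF assms] kappa2_eq[OF assms] kappa_f_eq[OF assms] kappa_s_eq by simp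

end

subsection \<open>The two kernels\<close>

lemma collision_weight_commute: "collision_weight \<beta> u v = collision_weight \<beta> v u"
  unfolding collision_weight_def by (simp add: mult_ac)

text \<open>For shape 1 the factors in \<open>u - z\<close> and \<open>v - z\<close> are indicators,
  which cut the integral of \<open>z powr (- 1/2)\<close> off at the minimum.\<close>

lemma collision_weight_one:
  assumes u: "0 < u" and v: "0 < v"
  shows "collision_weight 1 u v = ennreal (2 * sqrt (min u v))"
proof -
  let ?m = "min u v"
  have "((\<lambda>z. z powr (- 1/2)) has_integral ?m powr (- 1/2 + 1) / (- 1/2 + 1)) {0..?m}"
    using u v by (intro has_integral_powr_from_0) auto
  then have "(\<integral>\<^sup>+z. ennreal (indicator {0..?m} z * z powr (- 1/2)) \<partial>lborel) = ennreal (2 * sqrt ?m)"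
    using u v by (subst nn_integral_has_integral_lebesgue) (auto simp: powr_half_sqrt mult.commute)
  moreover have "collision_weight 1 u v = (\<integral>\<^sup>+z. ennreal (indicator {0..?m} z * z powr (- 1/2)) \<partial>lborel)"
    unfolding collision_weight_def
    by (intro nn_integral_cong_AE eventually_mono[OF AE_lborel_singleton[of ?m]])
      (auto simp: pos_powr_def indicator_def)
  ultimately show ?thesis by simp
qed

lemma elliptic_integrand_pos:
  fixes m \<theta> :: real
  assumes "0 \<le> m" "m < 1"
  shows "0 < 1 - m\<^sup>2 * (sin \<theta>)\<^sup>2"
proof -
  have "m\<^sup>2 * (sin \<theta>)\<^sup>2 \<le> m\<^sup>2 * 1"
    using abs_sin_le_one[of \<theta>] by (intro mult_left_mono) (auto simp: abs_square_le_1)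
  also have "\<dots> < 1" using assms by (simp add: power_less_one_iff abs_square_less_1)
  finally show ?thesis by simp
qed

lemma nn_integral_elliptic_K:
  assumes "0 \<le> m" "m < 1"
  shows "(\<integral>\<^sup>+\<theta>. ennreal (1 / sqrt (1 - m\<^sup>2 * (sin \<theta>)\<^sup>2)) * indicator {0..pi/2} \<theta> \<partial>lborel) =
      ennreal (elliptic_K m)"
    and "0 \<le> elliptic_K m"
proof -
  let ?f = "\<lambda>\<theta>. 1 / sqrt (1 - m\<^sup>2 * (sin \<theta>)\<^sup>2)"
  have pos: "0 < 1 - m\<^sup>2 * (sin \<theta>)\<^sup>2" for \<theta>
    by (rule elliptic_integrand_pos[OF assms])
  have "continuous_on {0..pi/2} ?f"
    using pos by (intro continuous_intros) (simp add: less_imp_neq[symmetric])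
  then have "set_integrable lborel {0..pi/2} ?f"
    by (rule borel_integrable_atLeastAtMost')
  then have i: "integrable lborel (\<lambda>\<theta>. indicator {0..pi/2} \<theta> * ?f \<theta>)"
    by (simp add: set_integrable_def)
  have nn: "0 \<le> indicator {0..pi/2} \<theta> * ?f \<theta>" for \<theta>
    using less_imp_le[OF pos] by simp
  show "0 \<le> elliptic_K m"
    using nn unfolding elliptic_K_def set_lebesgue_integral_def by (intro integral_nonneg_AE) simp
  have "(\<integral>\<^sup>+\<theta>. ennreal (?f \<theta>) * indicator {0..pi/2} \<theta> \<partial>lborel) =
      (\<integral>\<^sup>+\<theta>. ennreal (indicator {0..pi/2} \<theta> * ?f \<theta>) \<partial>lborel)"
    by (intro nn_integral_cong) (auto split: split_indicator)
  also have "\<dots> = ennreal (elliptic_K m)"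
    unfolding elliptic_K_def set_lebesgue_integral_def
    by (subst nn_integral_eq_integral[OF i]) (use nn in auto)
  finally show "(\<integral>\<^sup>+\<theta>. ennreal (?f \<theta>) * indicator {0..pi/2} \<theta> \<partial>lborel) = ennreal (elliptic_K m)" .
qed

text \<open>The substitution \<open>z = u (sin \<theta>)\<^sup>2\<close> turns the mixture into the elliptic integral.\<close>

lemma collision_weight_half:
  assumes u: "0 < u" and uv: "u < v"
  shows "collision_weight (1/2) u v = ennreal (2 * (sqrt (1 / v) * elliptic_K (sqrt (u / v))))"
proof -
  define m where "m = sqrt (u / v)"
  have v: "0 < v" using u uv by simp
  have m: "0 \<le> m" "m < 1" "m\<^sup>2 = u / v" using u uv v by (auto simp: m_def)
  define f :: "real \<Rightarrow> ennreal" where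
    "f = (\<lambda>z. ennreal (pos_powr (1/2) z * pos_powr (1/2) (u - z) * pos_powr (1/2) (v - z)))"
  have [measurable]: "f \<in> borel_measurable borel" unfolding f_def by measurable
  define g where "g = (\<lambda>\<theta>. u * (sin \<theta>)\<^sup>2)"
  define g' where "g' = (\<lambda>\<theta>. 2 * u * sin \<theta> * cos \<theta>)"
  have sc: "0 \<le> sin \<theta>" "0 \<le> cos \<theta>" if "\<theta> \<in> {0..pi/2}" for \<theta>
    using that by (auto intro!: sin_ge_zero cos_ge_zero)
  \<comment> \<open>\<open>g\<close> runs from 0 to \<open>u\<close>, and \<open>pos_powr\<close>
    makes the integrand vanish outside that range.\<close>
  have "collision_weight (1/2) u v = (\<integral>\<^sup>+z. f z * indicator {g 0..g (pi/2)} z \<partial>lborel)"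
    unfolding collision_weight_def f_def g_def
    by (intro nn_integral_cong) (auto simp: pos_powr_def split: split_indicator)
  also have "\<dots> = (\<integral>\<^sup>+\<theta>. f (g \<theta>) * ennreal (g' \<theta>) * indicator {0..pi/2} \<theta> \<partial>lborel)"
  proof (rule nn_integral_substitution_aux)
    show "(g has_real_derivative g' \<theta>) (at \<theta>)" for \<theta>
      unfolding g_def g'_def by (auto intro!: derivative_eq_intros)
    show "continuous_on {0..pi/2} g'" unfolding g'_def by (intro continuous_intros)
    show "0 \<le> g' \<theta>" if "\<theta> \<in> {0..pi/2}" for \<theta>
      using u sc[OF that] unfolding g'_def by simp
  qed auto
  also have "\<dots> = (\<integral>\<^sup>+\<theta>. ennreal (2 * sqrt (1 / v)) *
      (ennreal (1 / sqrt (1 - m\<^sup>2 * (sin \<theta>)\<^sup>2)) * indicator {0..pi/2} \<theta>) \<partial>lborel)"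
  proof (rule nn_integral_cong_AE)
    \<comment> \<open>At both endpoints \<open>pos_powr\<close> gives 0 in place of a singular
      factor, so the pointwise identity fails there.\<close>
    have "AE \<theta> in lborel. \<theta> \<noteq> (0::real) \<and> \<theta> \<noteq> pi/2"
      using AE_lborel_singleton[of "0::real"] AE_lborel_singleton[of "pi/2"] by eventually_elim auto
    then show "AE \<theta> in lborel. f (g \<theta>) * ennreal (g' \<theta>) * indicator {0..pi/2} \<theta> =
        ennreal (2 * sqrt (1 / v)) *
        (ennreal (1 / sqrt (1 - m\<^sup>2 * (sin \<theta>)\<^sup>2)) * indicator {0..pi/2} \<theta>)"
    proof eventually_elim
      case (elim \<theta>)
      show ?case
      proof (cases "\<theta> \<in> {0..pi/2}")
        case True
        then have s: "0 < sin \<theta>" and c: "0 < cos \<theta>"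
          using elim by (auto intro!: sin_gt_zero cos_gt_zero)
        have uc: "u - g \<theta> = u * (cos \<theta>)\<^sup>2"
          unfolding g_def cos_squared_eq by (simp add: algebra_simps)
        have vg: "v - g \<theta> = v * (1 - m\<^sup>2 * (sin \<theta>)\<^sup>2)"
          unfolding g_def m using v by (simp add: field_simps)
        have r: "0 < 1 - m\<^sup>2 * (sin \<theta>)\<^sup>2"
          by (rule elliptic_integrand_pos[OF m(1,2)])
        have pp: "pos_powr (1/2) t = 1 / sqrt t" if "0 < t" for t
          using that by (simp add: pos_powr_def powr_minus_divide powr_half_sqrt)
        have sg: "sqrt (g \<theta>) = sqrt u * sin \<theta>" "sqrt (u - g \<theta>) = sqrt u * cos \<theta>"
          unfolding uc unfolding g_def using s c u by (auto simp: real_sqrt_mult)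
        have "pos_powr (1/2) (g \<theta>) * pos_powr (1/2) (u - g \<theta>) * pos_powr (1/2) (v - g \<theta>) * g' \<theta> =
            1 / sqrt (g \<theta>) * (1 / sqrt (u - g \<theta>)) * (1 / sqrt (v - g \<theta>)) * g' \<theta>"
          using u v s c r by (subst (1 2 3) pp) (auto simp: uc vg, auto simp: g_def)
        also have "\<dots> = 2 * sqrt (1 / v) * (1 / sqrt (1 - m\<^sup>2 * (sin \<theta>)\<^sup>2))"
        proof -
          \<comment> \<open>\<open>x\<close>, \<open>y\<close>, \<open>R\<close> stand for the roots
            of \<open>u\<close>, \<open>v\<close> and the elliptic radicand; the two inverse roots
            of \<open>u\<close> cancel the factor \<open>u\<close> of \<open>g'\<close>.\<close>
          have "1 / (x * s) * (1 / (x * c)) * (1 / (y * R)) * (2 * (x * x) * s * c) = 2 * (1 / y) * (1 / R)"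
            if "0 < x" "0 < s" "0 < c" for x s c y R :: real
            using that by (simp add: field_simps)
          from this[of "sqrt u" "sin \<theta>" "cos \<theta>" "sqrt v" "sqrt (1 - m\<^sup>2 * (sin \<theta>)\<^sup>2)"]
          show ?thesis
            unfolding sg vg g'_def using u s c by (simp add: real_sqrt_mult real_sqrt_divide)
        qed
        finally show ?thesis
          using True s c u v r unfolding f_def
          by (simp add: ennreal_mult[symmetric] g'_def less_imp_le)
      qed simp
    qed
  qed
  also have "\<dots> = ennreal (2 * sqrt (1 / v)) * ennreal (elliptic_K m)"
    unfolding nn_integral_elliptic_K(1)[OF m(1,2), symmetric] by (rule nn_integral_cmult) measurable
  also have "\<dots> = ennreal (2 * (sqrt (1 / v) * elliptic_K m))"
    using v nn_integral_elliptic_K(2)[OF m(1,2)] by (simp add: ennreal_mult[symmetric] mult.assoc)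
  finally show ?thesis by (simp add: m_def)
qed

section \<open>Matching the case distinctions of the kernels with the mixture\<close>

lemma measurable_elliptic_K [measurable]: "elliptic_K \<in> borel_measurable borel"
  unfolding elliptic_K_def set_lebesgue_integral_def by measurable

text \<open>For a positive jump, the branches and the exchange of sites for \<open>a > b\<close>
  only sort the two energies \<open>a - \<eta>\<close> and \<open>b\<close>.\<close>

lemma W_GG2_pos:
  assumes "0 < a" "0 < b" "0 < \<eta>" "\<eta> < a" "\<eta> \<noteq> a - b"
  shows "W_GG2 a b \<eta> = sqrt (2 / pi ^ 3) *
    (sqrt (1 / max (a - \<eta>) b) * elliptic_K (sqrt (min (a - \<eta>) b / max (a - \<eta>) b)))"
  using assms by (auto simp: W_GG2_def W_GG2_le_def min_def max_def)

lemma W_GG2_neg: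
  assumes "0 < a" "0 < b" "- b < \<eta>" "\<eta> < 0" "\<eta> \<noteq> a - b"
  shows "W_GG2 a b \<eta> = sqrt (2 / pi ^ 3) *
    (sqrt (1 / max a (b + \<eta>)) * elliptic_K (sqrt (min a (b + \<eta>) / max a (b + \<eta>))))"
  using assms by (auto simp: W_GG2_def W_GG2_le_def min_def max_def add.commute)

text \<open>The diagonal \<open>u = v\<close> is a true exception: the mixture is infinite there,
  like the elliptic integral at modulus 1, whereas the Bochner integral in \<open>elliptic_K\<close>
  takes the value 0.\<close>

lemma collision_weight_half_min_max:
  assumes "0 < u" "0 < v" "u \<noteq> v"
  shows "ennreal (k * (sqrt (1 / max u v) * elliptic_K (sqrt (min u v / max u v)))) =
    ennreal (k / 2) * collision_weight (1/2) u v"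
proof -
  have *: "ennreal (k * (sqrt (1 / y) * elliptic_K (sqrt (x / y)))) =
      ennreal (k / 2) * collision_weight (1/2) x y" if "0 < x" "x < y" for x y
    using that nn_integral_elliptic_K(2)[of "sqrt (x / y)"]
    by (simp add: collision_weight_half ennreal_mult''[symmetric])
  show ?thesis
    using assms *[of u v] *[of v u] collision_weight_commute[of "1/2" u v]
    by (cases "u < v") (auto simp: min_def max_def)
qed

lemma W_GG2_nonneg: "0 < a \<Longrightarrow> 0 < b \<Longrightarrow> 0 \<le> W_GG2 a b \<eta>"
  unfolding W_GG2_def W_GG2_le_def
  by (auto intro!: mult_nonneg_nonneg nn_integral_elliptic_K(2))

text \<open>For \<open>d = 2\<close> the equilibrium energies are exponential, so the power parts of
  their densities are 1. The \<open>/ 2\<close> cancels the factor 2 in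
  \<open>collision_weight_half\<close>.\<close>

interpretation GG2: collision_kernel W_GG2 2 "1/2" "sqrt (2 / pi ^ 3) / 2"
proof
  show "(\<lambda>(a, b, \<eta>). W_GG2 a b \<eta>) \<in> borel_measurable (borel \<Otimes>\<^sub>M borel \<Otimes>\<^sub>M borel)"
    unfolding W_GG2_def W_GG2_le_def case_prod_unfold by measurable
qed (auto simp: W_GG2_nonneg pos_powr_def W_GG2_pos W_GG2_neg collision_weight_half_min_max)

text \<open>\<open>sqrt a * sqrt b\<close> is the power part of the equilibrium densities for
  \<open>d = 3\<close>. It clears the denominators, and all branches become the root of the smaller
  of \<open>a - \<eta>\<close> and \<open>b\<close>.\<close>

lemma W_GG3_pos:
  assumes "0 < a" "0 < b" "0 < \<eta>" "\<eta> < a" "\<eta> \<noteq> a - b"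
  shows "sqrt a * sqrt b * W_GG3 a b \<eta> = sqrt (pi / 8) * sqrt (min (a - \<eta>) b)"
  using assms by (auto simp: W_GG3_def min_def max_def real_sqrt_mult real_sqrt_divide)

lemma W_GG3_neg:
  assumes "0 < a" "0 < b" "- b < \<eta>" "\<eta> < 0" "\<eta> \<noteq> a - b"
  shows "sqrt a * sqrt b * W_GG3 a b \<eta> = sqrt (pi / 8) * sqrt (min a (b + \<eta>))"
  using assms by (auto simp: W_GG3_def min_def max_def real_sqrt_mult real_sqrt_divide)

text \<open>The \<open>/ 2\<close> cancels the factor 2 from integrating
  \<open>z powr (- 1/2)\<close>.\<close>

interpretation GG3: collision_kernel W_GG3 3 1 "sqrt (pi / 8) / 2"
proof
  show "(\<lambda>(a, b, \<eta>). W_GG3 a b \<eta>) \<in> borel_measurable (borel \<Otimes>\<^sub>M borel \<Otimes>\<^sub>M borel)"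
    unfolding W_GG3_def case_prod_unfold by measurable
  have pp: "pos_powr (1 + 1/2) x = sqrt x" if "0 < x" for x
    using that by (simp add: pos_powr_def powr_half_sqrt)
  have w: "ennreal (sqrt (pi / 8) / 2) * collision_weight 1 u v = ennreal (sqrt (pi / 8) * sqrt (min u v))"
    if "0 < u" "0 < v" for u v
    using that by (simp add: collision_weight_one ennreal_mult[symmetric])
  show "ennreal (pos_powr (1 + 1/2) a * pos_powr (1 + 1/2) b * W_GG3 a b \<eta>) =
      ennreal (sqrt (pi / 8) / 2) * collision_weight 1 (a - \<eta>) b"
    if "0 < a" "0 < b" "0 < \<eta>" "\<eta> < a" "\<eta> \<noteq> a - b" for a b \<eta>
    unfolding pp[OF that(1)] pp[OF that(2)] W_GG3_pos[OF that] using that by (simp add: w)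
  show "ennreal (pos_powr (1 + 1/2) a * pos_powr (1 + 1/2) b * W_GG3 a b \<eta>) =
      ennreal (sqrt (pi / 8) / 2) * collision_weight 1 a (b + \<eta>)"
    if "0 < a" "0 < b" "- b < \<eta>" "\<eta> < 0" "\<eta> \<noteq> a - b" for a b \<eta>
    unfolding pp[OF that(1)] pp[OF that(2)] W_GG3_neg[OF that] using that by (simp add: w)
  show "0 \<le> W_GG3 a b \<eta>" if "0 < a" "0 < b" "- b < \<eta>" "\<eta> < a" for a b \<eta>
    using that by (auto simp: W_GG3_def)
qed auto

theorem mainTheorem4:
  fixes W :: kernel and d :: nat and a b :: int
  assumes "(W, d) \<in> {(W_GG2, 2), (W_GG3, 3)}"
    and "\<bar>a - b\<bar> = 1"
  shows "kappa W d < kappa_s W d \<and> kappa_s W d = kappa1 W d a b \<and>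
    kappa1 W d a b = kappa2 W d a b \<and> kappa2 W d a b = kappa_f W d a b"
proof -
  have "a \<noteq> b" using assms(2) by auto
  then show ?thesis
    using assms(1) GG2.conductivities[of a b] GG3.conductivities[of a b] by auto
qed

end
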